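(* Let $\mathcal{D}$ be a weighted oriented uni-directed line with $V(\mathcal{D})=\{x_1,x_2,x_3,\ldots,x_n\}$ and $E(\mathcal{D})=\{(x_i,x_{i+1}) \mid 1\leq i\leq n-1\}$, and write $w_i=w(x_i)$. Let $I(\mathcal{D})$ be its edge ideal. Then $I(\mathcal{D})^{(s)}=I(\mathcal{D})^s$ for all $s\geq 1$ if and only if the following condition is satisfied: if $w_j\geq 2$ for some $1<j<n$, then $w_i\geq 2$ for all $j\leq i\leq n-1$.
   Context: A weighted oriented graph is a triple $\mathcal{D}=(V(\mathcal{D}),E(\mathcal{D}),w)$, where $V(\mathcal{D})$ is the finite vertex set of a finite simple undirected graph $G$ (the underlying graph), $E(\mathcal{D})\subseteq V(\mathcal{D})\times V(\mathcal{D})$ is a set of directed edges obtained by giving each edge of $G$ exactly one direction ($(u,v)\in E(\mathcal{D})$ means an edge directed from $u$ to $v$), and $w:V(\mathcal{D})\to\mathbb{N}=\{1,2,\dots\}$ is a weight function. With $V(\mathcal{D})=\{x_1,\dots,x_n\}$, the vertices are identified with the variables of the polynomial ring $R=k[x_1,\dots,x_n]$ over a field $k$, and the edge ideal of $\mathcal{D}$ is the monomial ideal $I(\mathcal{D})=(\,x_i x_j^{w(x_j)} : (x_i,x_j)\in E(\mathcal{D})\,)\subseteq R$. For an ideal $I$ of $R$ and $s\ge 1$, the $s$-th symbolic power is $I^{(s)}=\bigcap_{\mathfrak{p}\in\operatorname{Ass}(I)}(I^sR_{\mathfrak{p}}\cap R)$, where $\operatorname{Ass}(I)=\operatorname{Ass}(R/I)$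 is the set of all associated primes of $I$ (including embedded ones). *)

theory Defs
  imports
    "HOL-Algebra.QuotRing"
    "HOL-Algebra.Ideal_Product"
    "HOL-Library.Poly_Mapping"
begin

section \<open>Localization and symbolic powers\<close>

definition loc_rel :: "('a, 'm) ring_scheme \<Rightarrow> 'a set \<Rightarrow> (('a \<times> 'a) \<times> ('a \<times> 'a)) set" where
  "loc_rel R S = {((a, s), (b, t)). a \<in> carrier R \<and> b \<in> carrier R \<and> s \<in> S \<and> t \<in> S \<and>
     (\<exists>u\<in>S. u \<otimes>\<^bsub>R\<^esub> (a \<otimes>\<^bsub>R\<^esub> t \<ominus>\<^bsub>R\<^esub> b \<otimes>\<^bsub>R\<^esub> s) = \<zero>\<^bsub>R\<^esub>)}"

definition loc_frac :: "('a, 'm) ring_scheme \<Rightarrow> 'a set \<Rightarrow> 'a \<Rightarrow> 'a \<Rightarrow> ('a \<times> 'a) set" where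
  "loc_frac R S a s = loc_rel R S `` {(a, s)}"

text \<open>The ring of fractions \<open>S\<inverse>R\<close>, intended for a commutative ring \<open>R\<close> and a multiplicatively
  closed set \<open>S\<close>. The sum and the product of two classes are written as unions over all
  representatives; these unions are single classes because the operations are well defined.\<close>

definition localization :: "('a, 'm) ring_scheme \<Rightarrow> 'a set \<Rightarrow> (('a \<times> 'a) set) ring" where
  "localization R S =
    \<lparr> carrier = (carrier R \<times> S) // loc_rel R S,
      mult = (\<lambda>X Y. \<Union>(a, s)\<in>X. \<Union>(b, t)\<in>Y. loc_frac R S (a \<otimes>\<^bsub>R\<^esub> b) (s \<otimes>\<^bsub>R\<^esub> t)),
      one = loc_frac R S \<one>\<^bsub>R\<^esub> \<one>\<^bsub>R\<^esub>,
      zero = loc_frac R S \<zero>\<^bsub>R\<^esub> \<one>\<^bsub>R\<^esub>,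
      add = (\<lambda>X Y. \<Union>(a, s)\<in>X. \<Union>(b, t)\<in>Y.
               loc_frac R S (a \<otimes>\<^bsub>R\<^esub> t \<oplus>\<^bsub>R\<^esub> b \<otimes>\<^bsub>R\<^esub> s) (s \<otimes>\<^bsub>R\<^esub> t)) \<rparr>"

text \<open>For a prime ideal \<open>P\<close>, the contraction \<open>J R\<^sub>P \<inter> R\<close>, i.e. the preimage under
  \<open>R \<rightarrow> R\<^sub>P\<close> of the extension of \<open>J\<close>.\<close>

definition loc_contraction :: "('a, 'm) ring_scheme \<Rightarrow> 'a set \<Rightarrow> 'a set \<Rightarrow> 'a set" where
  "loc_contraction R P J =
    {f \<in> carrier R. loc_frac R (carrier R - P) f \<one>\<^bsub>R\<^esub>
       \<in> Idl\<^bsub>localization R (carrier R - P)\<^esub> ((\<lambda>a. loc_frac R (carrier R - P) a \<one>\<^bsub>R\<^esub>) ` J)}"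

text \<open>The associated primes of the \<open>R\<close>-module \<open>R/I\<close>: prime ideals that are the annihilator of
  an element \<open>y\<close> of \<open>R/I\<close>.\<close>

definition associated_primes :: "('a, 'm) ring_scheme \<Rightarrow> 'a set \<Rightarrow> 'a set set" where
  "associated_primes R I =
    {P. primeideal P R \<and>
        (\<exists>y\<in>carrier (R Quot I).
           P = {r \<in> carrier R. (I +>\<^bsub>R\<^esub> r) \<otimes>\<^bsub>R Quot I\<^esub> y = \<zero>\<^bsub>R Quot I\<^esub>})}"

definition ideal_power :: "('a, 'm) ring_scheme \<Rightarrow> 'a set \<Rightarrow> nat \<Rightarrow> 'a set" where
  "ideal_power R I s = I [^]\<^bsub>ideals_set R\<^esub> s"

text \<open>The intersection is taken inside \<open>carrier R\<close>, so that it is \<open>R\<close> when \<open>I\<close> has no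
  associated primes (\<open>I = R\<close>).\<close>

definition symbolic_power :: "('a, 'm) ring_scheme \<Rightarrow> 'a set \<Rightarrow> nat \<Rightarrow> 'a set" where
  "symbolic_power R I s =
    carrier R \<inter> (\<Inter>P\<in>associated_primes R I. loc_contraction R P (ideal_power R I s))"


section \<open>Polynomial rings\<close>

text \<open>A polynomial is a finitely supported function from monomials to coefficients, and a
  monomial is a finitely supported function from variables to exponents.\<close>

type_synonym ('v, 'k) mpoly = "('v \<Rightarrow>\<^sub>0 nat) \<Rightarrow>\<^sub>0 'k"

definition Var :: "'v \<Rightarrow> ('v, 'k::field) mpoly" where
  "Var v = Poly_Mapping.single (Poly_Mapping.single v 1) 1"

text \<open>The ring \<open>k[V]\<close> of polynomials all of whose variables lie in \<open>V\<close>.\<close>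

definition mpoly_ring :: "'v set \<Rightarrow> ('v, 'k::field) mpoly ring" where
  "mpoly_ring V =
    \<lparr> carrier = {p. \<forall>m\<in>Poly_Mapping.keys p. Poly_Mapping.keys m \<subseteq> V},
      mult = (*), one = 1, zero = 0, add = (+) \<rparr>"


section \<open>Weighted oriented graphs and their edge ideals\<close>

record 'v wo_graph =
  vertices :: "'v set"
  edges :: "('v \<times> 'v) set"
  weight :: "'v \<Rightarrow> nat"

text \<open>Orienting each edge of a simple graph in exactly one way yields precisely the asymmetric
  relations; in particular there are no loops.\<close>

locale weighted_oriented_graph =
  fixes D :: "'v wo_graph"
  assumes finite_vertices: "finite (vertices D)"
    and edges_subset: "edges D \<subseteq> vertices D \<times> vertices D"
    and edges_asym: "(u, v) \<in> edges D \<Longrightarrow> (v, u) \<notin> edges D"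
    and weight_pos: "v \<in> vertices D \<Longrightarrow> weight D v \<ge> 1"

definition edge_ideal :: "'v wo_graph \<Rightarrow> ('v, 'k::field) mpoly set" where
  "edge_ideal D = Idl\<^bsub>mpoly_ring (vertices D)\<^esub> {Var u * Var v ^ weight D v | u v. (u, v) \<in> edges D}"

end

theory Submission
  imports Defs
begin

text \<open>For monomial ideals everything reduces to exponent vectors: \<open>I\<^sup>s\<close> is spanned by the monomials
  divisible by a product of \<open>s\<close> generators, and contracting from the localization at a monomial prime
  \<open>P\<^sub>C = (x\<^sub>i : i \<in> C)\<close> means ignoring the exponents outside \<open>C\<close>.

  If the weight condition holds, the largest \<open>s\<close> with \<open>m \<in> I\<^sup>s\<close> is found by using the edges greedily
  from the sink end of the line. Reading the greedy solution from the other end yields a strong vertex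
  cover \<open>C\<close>, hence an associated prime \<open>P\<^sub>C\<close>, such that the greedy value stays optimal when the
  exponents outside \<open>C\<close> are made infinite; so \<open>m \<in> I\<^sup>(\<^sup>s\<^sup>)\<close> forces \<open>m \<in> I\<^sup>s\<close>.

  If it fails, there are consecutive vertices \<open>a, b, c, d\<close> with \<open>w b \<ge> 2\<close> and \<open>w c = 1\<close>. Then
  \<open>a b\<^sup>w c\<^sup>2 d\<close> lies in the third symbolic but not the third ordinary power when \<open>w d = 1\<close>, and \<open>a b\<^sup>w c d\<close>
  does so for the second powers when \<open>w d \<ge> 2\<close>: no associated prime contains \<open>b, c, d\<close> and the
  vertex after \<open>d\<close> (if any), and multiplying by a power of any of these lands in the ordinary power.\<close>

section \<open>Localization and associated primes\<close>

locale mult_closed_set = cring R for R (structure) +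
  fixes S
  assumes S_sub: "S \<subseteq> carrier R"
    and S_one: "\<one> \<in> S"
    and S_mult: "s \<in> S \<Longrightarrow> t \<in> S \<Longrightarrow> s \<otimes> t \<in> S"
begin

abbreviation "L \<equiv> localization R S"

lemma S_carrier [simp, intro]: "s \<in> S \<Longrightarrow> s \<in> carrier R"
  using S_sub by blast

lemma minus_eq_zero_iff:
  assumes "x \<in> carrier R" "y \<in> carrier R"
  shows "x \<ominus> y = \<zero> \<longleftrightarrow> x = y"
proof
  assume "x \<ominus> y = \<zero>"
  then have "\<ominus> (\<ominus> y) = x"
    using assms by (intro minus_equality) (simp_all add: minus_eq)
  then show "x = y"
    using assms by simp
qed (use assms in \<open>simp add: minus_eq r_neg\<close>)

lemma loc_rel_iff:
  "((a, s), (b, t)) \<in> loc_rel R S \<longleftrightarrow> a \<in> carrier R \<and> b \<in> carrier R \<and> s \<in> S \<and> t \<in> S \<and>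
     (\<exists>u\<in>S. u \<otimes> (a \<otimes> t) = u \<otimes> (b \<otimes> s))"
proof -
  have "u \<otimes> (a \<otimes> t \<ominus> b \<otimes> s) = \<zero> \<longleftrightarrow> u \<otimes> (a \<otimes> t) = u \<otimes> (b \<otimes> s)"
    if "a \<in> carrier R" "b \<in> carrier R" "s \<in> S" "t \<in> S" "u \<in> S" for u
  proof -
    have "u \<otimes> (a \<otimes> t \<ominus> b \<otimes> s) = u \<otimes> (a \<otimes> t) \<ominus> u \<otimes> (b \<otimes> s)"
      using that by (simp add: minus_eq r_distr r_minus)
    then show ?thesis
      using that by (simp add: minus_eq_zero_iff)
  qed
  then show ?thesis
    unfolding loc_rel_def by auto
qed

lemma loc_rel_trans:
  assumes "((a, s), (b, t)) \<in> loc_rel R S" "((b, t), (c, r)) \<in> loc_rel R S"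
  shows "((a, s), (c, r)) \<in> loc_rel R S"
proof -
  obtain u v where c: "a \<in> carrier R" "b \<in> carrier R" "c \<in> carrier R"
      "s \<in> S" "t \<in> S" "r \<in> S" "u \<in> S" "v \<in> S"
    and u: "u \<otimes> (a \<otimes> t) = u \<otimes> (b \<otimes> s)" and v: "v \<otimes> (b \<otimes> r) = v \<otimes> (c \<otimes> t)"
    using assms unfolding loc_rel_iff by blast
  \<comment> \<open>Denominators cannot be cancelled when there are zero divisors, so the middle
    denominator \<open>t\<close> stays as a factor of the witness
    \<open>u \<otimes> v \<otimes> t\<close>.\<close>
  have "(u \<otimes> v \<otimes> t) \<otimes> (a \<otimes> r) = (v \<otimes> r) \<otimes> (u \<otimes> (a \<otimes> t))"
    using c by (simp add: m_ac)
  also have "\<dots> = (u \<otimes> s) \<otimes> (v \<otimes> (b \<otimes> r))"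
    unfolding u using c by (simp add: m_ac)
  also have "\<dots> = (u \<otimes> v \<otimes> t) \<otimes> (c \<otimes> s)"
    unfolding v using c by (simp add: m_ac)
  finally show ?thesis
    unfolding loc_rel_iff using c S_mult by blast
qed

lemma loc_rel_equiv: "equiv (carrier R \<times> S) (loc_rel R S)"
proof (rule equivI)
  show "loc_rel R S \<subseteq> (carrier R \<times> S) \<times> (carrier R \<times> S)"
    by (auto simp: loc_rel_iff)
  show "refl_on (carrier R \<times> S) (loc_rel R S)"
    using S_one by (auto simp: refl_on_def loc_rel_iff)
  show "sym (loc_rel R S)"
    unfolding sym_def by (auto simp: loc_rel_iff) metis
  show "trans (loc_rel R S)"
    unfolding trans_def split_paired_All using loc_rel_trans by blast
qed

lemma loc_frac_eq_iff:
  assumes "a \<in> carrier R" "b \<in> carrier R" "s \<in> S" "t \<in> S"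
  shows "loc_frac R S a s = loc_frac R S b t \<longleftrightarrow> (\<exists>u\<in>S. u \<otimes> (a \<otimes> t) = u \<otimes> (b \<otimes> s))"
  unfolding loc_frac_def using eq_equiv_class_iff[OF loc_rel_equiv, of "(a, s)" "(b, t)"] assms
  by (simp add: loc_rel_iff)

lemma loc_frac_cong:
  assumes "a \<in> carrier R" "b \<in> carrier R" "s \<in> S" "t \<in> S" "a \<otimes> t = b \<otimes> s"
  shows "loc_frac R S a s = loc_frac R S b t"
  using loc_frac_eq_iff[OF assms(1-4)] assms(5) S_one by auto

lemma loc_frac_mem_iff: "(b, t) \<in> loc_frac R S a s \<longleftrightarrow> ((a, s), (b, t)) \<in> loc_rel R S"
  by (simp add: loc_frac_def)

lemma carrier_L: "carrier L = {loc_frac R S a s | a s. a \<in> carrier R \<and> s \<in> S}"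
  by (auto simp: localization_def loc_frac_def quotient_def)

lemma loc_frac_in_L [simp]: "a \<in> carrier R \<Longrightarrow> s \<in> S \<Longrightarrow> loc_frac R S a s \<in> carrier L"
  by (auto simp: carrier_L)

lemma one_L: "\<one>\<^bsub>L\<^esub> = loc_frac R S \<one> \<one>" and zero_L: "\<zero>\<^bsub>L\<^esub> = loc_frac R S \<zero> \<one>"
  by (simp_all add: localization_def)

text \<open>Reduces the unions over representatives in \<open>localization\<close> to
  well-definedness: classes are nonempty, and a union of equal values is that value.\<close>

lemma UN_loc_frac:
  assumes "a \<in> carrier R" "s \<in> S" "b \<in> carrier R" "t \<in> S"
    and "\<And>a' s' b' t'. ((a, s), (a', s')) \<in> loc_rel R S \<Longrightarrow> ((b, t), (b', t')) \<in> loc_rel R S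
      \<Longrightarrow> F a' s' b' t' = Z"
  shows "(\<Union>(a', s')\<in>loc_frac R S a s. \<Union>(b', t')\<in>loc_frac R S b t. F a' s' b' t') = Z"
proof -
  have "(a, s) \<in> loc_frac R S a s" "(b, t) \<in> loc_frac R S b t"
    using assms S_one by (auto simp: loc_frac_mem_iff loc_rel_iff)
  moreover have "F a' s' b' t' = Z" if "(a', s') \<in> loc_frac R S a s" "(b', t') \<in> loc_frac R S b t"
    for a' s' b' t'
    using that assms(5) by (simp add: loc_frac_mem_iff)
  ultimately show ?thesis
    by fastforce
qed

lemma mult_L:
  assumes "a \<in> carrier R" "s \<in> S" "b \<in> carrier R" "t \<in> S"
  shows "loc_frac R S a s \<otimes>\<^bsub>L\<^esub> loc_frac R S b t = loc_frac R S (a \<otimes> b) (s \<otimes> t)"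
proof -
  have "loc_frac R S (a' \<otimes> b') (s' \<otimes> t') = loc_frac R S (a \<otimes> b) (s \<otimes> t)"
    if r: "((a, s), (a', s')) \<in> loc_rel R S" "((b, t), (b', t')) \<in> loc_rel R S" for a' s' b' t'
  proof -
    obtain u v where c: "a' \<in> carrier R" "b' \<in> carrier R" "s' \<in> S" "t' \<in> S" "u \<in> S" "v \<in> S"
      and u: "u \<otimes> (a \<otimes> s') = u \<otimes> (a' \<otimes> s)" and v: "v \<otimes> (b \<otimes> t') = v \<otimes> (b' \<otimes> t)"
      using r unfolding loc_rel_iff by blast
    have "(u \<otimes> v) \<otimes> ((a' \<otimes> b') \<otimes> (s \<otimes> t)) = (u \<otimes> (a' \<otimes> s)) \<otimes> (v \<otimes> (b' \<otimes> t))"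
      using c assms by (simp add: m_ac)
    also have "\<dots> = (u \<otimes> v) \<otimes> ((a \<otimes> b) \<otimes> (s' \<otimes> t'))"
      unfolding u[symmetric] v[symmetric] using c assms by (simp add: m_ac)
    finally show ?thesis
      using c assms S_mult by (subst loc_frac_eq_iff) auto
  qed
  then show ?thesis
    unfolding localization_def ring.simps monoid.simps
    using assms by (intro UN_loc_frac) blast+
qed

lemma add_L:
  assumes "a \<in> carrier R" "s \<in> S" "b \<in> carrier R" "t \<in> S"
  shows "loc_frac R S a s \<oplus>\<^bsub>L\<^esub> loc_frac R S b t = loc_frac R S (a \<otimes> t \<oplus> b \<otimes> s) (s \<otimes> t)"
proof -
  have "loc_frac R S (a' \<otimes> t' \<oplus> b' \<otimes> s') (s' \<otimes> t') = loc_frac R S (a \<otimes> t \<oplus> b \<otimes> s) (s \<otimes> t)"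
    if r: "((a, s), (a', s')) \<in> loc_rel R S" "((b, t), (b', t')) \<in> loc_rel R S" for a' s' b' t'
  proof -
    obtain u v where c: "a' \<in> carrier R" "b' \<in> carrier R" "s' \<in> S" "t' \<in> S" "u \<in> S" "v \<in> S"
      and u: "u \<otimes> (a \<otimes> s') = u \<otimes> (a' \<otimes> s)" and v: "v \<otimes> (b \<otimes> t') = v \<otimes> (b' \<otimes> t)"
      using r unfolding loc_rel_iff by blast
    have "(u \<otimes> v) \<otimes> ((a' \<otimes> t' \<oplus> b' \<otimes> s') \<otimes> (s \<otimes> t))
        = (u \<otimes> (a' \<otimes> s)) \<otimes> (v \<otimes> t \<otimes> t') \<oplus> (v \<otimes> (b' \<otimes> t)) \<otimes> (u \<otimes> s \<otimes> s')"
      using c assms by (simp add: m_ac l_distr r_distr)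
    also have "\<dots> = (u \<otimes> v) \<otimes> ((a \<otimes> t \<oplus> b \<otimes> s) \<otimes> (s' \<otimes> t'))"
      unfolding u[symmetric] v[symmetric] using c assms by (simp add: m_ac l_distr r_distr)
    finally show ?thesis
      using c assms S_mult by (subst loc_frac_eq_iff) auto
  qed
  then show ?thesis
    unfolding localization_def ring.simps monoid.simps
    using assms by (intro UN_loc_frac) blast+
qed

lemma L_cases [consumes 1]:
  assumes "x \<in> carrier L"
  obtains a s where "a \<in> carrier R" "s \<in> S" "x = loc_frac R S a s"
  using assms by (auto simp: carrier_L)

lemma neg_L:
  assumes "a \<in> carrier R" "s \<in> S"
  shows "loc_frac R S (\<ominus> a) s \<oplus>\<^bsub>L\<^esub> loc_frac R S a s = \<zero>\<^bsub>L\<^esub>"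
proof -
  have "(\<ominus> a) \<otimes> s \<oplus> a \<otimes> s = \<zero>"
    using assms by (simp add: l_minus l_neg)
  then show ?thesis
    using assms S_one S_mult by (simp add: add_L zero_L) (rule loc_frac_cong, auto)
qed

lemma ring_L: "ring L"
proof (rule ringI)
  show "abelian_group L"
  proof (rule abelian_groupI)
    fix x y assume "x \<in> carrier L" "y \<in> carrier L"
    then show "x \<oplus>\<^bsub>L\<^esub> y \<in> carrier L"
      by (auto elim!: L_cases simp: add_L S_mult)
  next
    show "\<zero>\<^bsub>L\<^esub> \<in> carrier L"
      using S_one by (simp add: zero_L)
  next
    fix x y z assume "x \<in> carrier L" "y \<in> carrier L" "z \<in> carrier L"
    then obtain a s b t c u where *: "a \<in> carrier R" "b \<in> carrier R" "c \<in> carrier R"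
      "s \<in> S" "t \<in> S" "u \<in> S"
      "x = loc_frac R S a s" "y = loc_frac R S b t" "z = loc_frac R S c u"
      by (auto elim!: L_cases)
    then show "x \<oplus>\<^bsub>L\<^esub> y \<oplus>\<^bsub>L\<^esub> z = x \<oplus>\<^bsub>L\<^esub> (y \<oplus>\<^bsub>L\<^esub> z)"
      by (simp add: add_L S_mult) (intro arg_cong2[where f = "loc_frac R S"]; simp add: m_ac a_ac l_distr r_distr)
  next
    fix x y assume "x \<in> carrier L" "y \<in> carrier L"
    then show "x \<oplus>\<^bsub>L\<^esub> y = y \<oplus>\<^bsub>L\<^esub> x"
      by (auto elim!: L_cases simp: add_L a_comm m_comm)
  next
    fix x assume "x \<in> carrier L"
    then show "\<zero>\<^bsub>L\<^esub> \<oplus>\<^bsub>L\<^esub> x = x"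
      using S_one by (auto elim!: L_cases simp: zero_L add_L)
  next
    fix x assume "x \<in> carrier L"
    then obtain a s where "a \<in> carrier R" "s \<in> S" "x = loc_frac R S a s"
      by (auto elim!: L_cases)
    then show "\<exists>y\<in>carrier L. y \<oplus>\<^bsub>L\<^esub> x = \<zero>\<^bsub>L\<^esub>"
      using neg_L by (intro bexI[of _ "loc_frac R S (\<ominus> a) s"]) auto
  qed
next
  show "Group.monoid L"
  proof (rule monoidI)
    fix x y assume "x \<in> carrier L" "y \<in> carrier L"
    then show "x \<otimes>\<^bsub>L\<^esub> y \<in> carrier L"
      by (auto elim!: L_cases simp: mult_L S_mult)
  next
    show "\<one>\<^bsub>L\<^esub> \<in> carrier L"
      using S_one by (simp add: one_L)
  next
    fix x y z assume "x \<in> carrier L" "y \<in> carrier L" "z \<in> carrier L"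
    then show "x \<otimes>\<^bsub>L\<^esub> y \<otimes>\<^bsub>L\<^esub> z = x \<otimes>\<^bsub>L\<^esub> (y \<otimes>\<^bsub>L\<^esub> z)"
      by (auto elim!: L_cases simp: mult_L S_mult m_assoc)
  next
    fix x assume "x \<in> carrier L"
    then show "\<one>\<^bsub>L\<^esub> \<otimes>\<^bsub>L\<^esub> x = x" "x \<otimes>\<^bsub>L\<^esub> \<one>\<^bsub>L\<^esub> = x"
      using S_one by (auto elim!: L_cases simp: one_L mult_L)
  qed
next
  fix x y z assume "x \<in> carrier L" "y \<in> carrier L" "z \<in> carrier L"
  then obtain a s b t c u where *: "a \<in> carrier R" "b \<in> carrier R" "c \<in> carrier R"
    "s \<in> S" "t \<in> S" "u \<in> S"
    "x = loc_frac R S a s" "y = loc_frac R S b t" "z = loc_frac R S c u"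
    by (auto elim!: L_cases)
  then show "(x \<oplus>\<^bsub>L\<^esub> y) \<otimes>\<^bsub>L\<^esub> z = x \<otimes>\<^bsub>L\<^esub> z \<oplus>\<^bsub>L\<^esub> y \<otimes>\<^bsub>L\<^esub> z"
    by (simp add: add_L mult_L S_mult) (rule loc_frac_cong; simp add: S_mult m_ac a_ac l_distr r_distr)
  from * show "z \<otimes>\<^bsub>L\<^esub> (x \<oplus>\<^bsub>L\<^esub> y) = z \<otimes>\<^bsub>L\<^esub> x \<oplus>\<^bsub>L\<^esub> z \<otimes>\<^bsub>L\<^esub> y"
    by (simp add: add_L mult_L S_mult) (rule loc_frac_cong; simp add: S_mult m_ac a_ac l_distr r_distr)
qed

text \<open>An explicit candidate for the extension of \<open>J\<close>. It is closed under sums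
  because passing to a common denominator only multiplies numerators by ring elements.\<close>

lemma extension_ideal:
  assumes "ideal J R"
  shows "ideal {loc_frac R S a s | a s. a \<in> J \<and> s \<in> S} L" (is "ideal ?K L")
proof -
  interpret J: ideal J R by fact
  interpret L: ring L by (rule ring_L)
  have carr: "a \<in> carrier R" if "a \<in> J" for a
    using that by (rule J.Icarr)
  have KI: "loc_frac R S a s \<in> ?K" if "a \<in> J" "s \<in> S" for a s
    using that by blast
  show ?thesis
  proof (rule idealI)
    show "ring L" by (rule ring_L)
    show "subgroup ?K (add_monoid L)"
    proof (rule L.add.subgroupI)
      show "?K \<subseteq> carrier L"
        using carr by auto
      show "?K \<noteq> {}"
        using J.zero_closed S_one by blast
    next
      fix x assume "x \<in> ?K"
      then obtain a s where "a \<in> J" "s \<in> S" "x = loc_frac R S a s"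
        by blast
      moreover from this have "\<ominus>\<^bsub>L\<^esub> x = loc_frac R S (\<ominus> a) s"
        using neg_L carr L.minus_equality by simp
      ultimately show "\<ominus>\<^bsub>L\<^esub> x \<in> ?K"
        using KI J.a_inv_closed by simp
    next
      fix x y assume "x \<in> ?K" "y \<in> ?K"
      then obtain a s b t where *: "a \<in> J" "s \<in> S" "x = loc_frac R S a s"
          "b \<in> J" "t \<in> S" "y = loc_frac R S b t"
        by blast
      then have "x \<oplus>\<^bsub>L\<^esub> y = loc_frac R S (a \<otimes> t \<oplus> b \<otimes> s) (s \<otimes> t)"
        using carr by (simp add: add_L)
      moreover have "a \<otimes> t \<oplus> b \<otimes> s \<in> J"
        using * by (intro J.a_closed J.I_r_closed) auto
      ultimately show "x \<oplus>\<^bsub>L\<^esub> y \<in> ?K"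
        using KI S_mult * by simp
    qed
  next
    fix x y assume "x \<in> ?K" "y \<in> carrier L"
    then obtain a s b t where *: "a \<in> J" "s \<in> S" "x = loc_frac R S a s"
        "b \<in> carrier R" "t \<in> S" "y = loc_frac R S b t"
      by (auto elim!: L_cases)
    then have "y \<otimes>\<^bsub>L\<^esub> x = loc_frac R S (b \<otimes> a) (t \<otimes> s)"
        "x \<otimes>\<^bsub>L\<^esub> y = loc_frac R S (a \<otimes> b) (s \<otimes> t)"
      using carr by (simp_all add: mult_L)
    moreover have "b \<otimes> a \<in> J" "a \<otimes> b \<in> J"
      using * by (auto intro: J.I_l_closed J.I_r_closed)
    ultimately show "y \<otimes>\<^bsub>L\<^esub> x \<in> ?K" "x \<otimes>\<^bsub>L\<^esub> y \<in> ?K"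
      using KI S_mult * by simp_all
  qed
qed

text \<open>Clearing denominators in f/1 = a/s gives
  \<open>(u \<otimes> s) \<otimes> f = u \<otimes> a\<close>, which lies in \<open>J\<close>.
  Conversely f/1 is the product of 1/h and (hf)/1.\<close>

lemma loc_frac_mem_extension_iff:
  assumes J: "ideal J R" and f: "f \<in> carrier R"
  shows "loc_frac R S f \<one> \<in> Idl\<^bsub>L\<^esub> ((\<lambda>a. loc_frac R S a \<one>) ` J) \<longleftrightarrow> (\<exists>h\<in>S. h \<otimes> f \<in> J)"
proof
  interpret J: ideal J R by fact
  interpret L: ring L by (rule ring_L)
  let ?K = "{loc_frac R S a s | a s. a \<in> J \<and> s \<in> S}"
  assume "loc_frac R S f \<one> \<in> Idl\<^bsub>L\<^esub> ((\<lambda>a. loc_frac R S a \<one>) ` J)"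
  moreover have "Idl\<^bsub>L\<^esub> ((\<lambda>a. loc_frac R S a \<one>) ` J) \<subseteq> ?K"
    using S_one by (intro L.genideal_minimal extension_ideal J) blast
  ultimately obtain a s where "a \<in> J" "s \<in> S" "loc_frac R S f \<one> = loc_frac R S a s"
    by blast
  then obtain u where u: "u \<in> S" "u \<otimes> (f \<otimes> s) = u \<otimes> (a \<otimes> \<one>)"
    using loc_frac_eq_iff[of f a \<one> s] f S_one J.Icarr by blast
  have "(u \<otimes> s) \<otimes> f = u \<otimes> (f \<otimes> s)"
    using u \<open>s \<in> S\<close> f by (simp add: m_ac)
  also have "\<dots> = u \<otimes> a"
    using u \<open>a \<in> J\<close> J.Icarr by simp
  finally have "(u \<otimes> s) \<otimes> f \<in> J"
    using \<open>a \<in> J\<close> u J.I_l_closed by auto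
  then show "\<exists>h\<in>S. h \<otimes> f \<in> J"
    using u \<open>s \<in> S\<close> S_mult by blast
next
  interpret J: ideal J R by fact
  interpret L: ring L by (rule ring_L)
  assume "\<exists>h\<in>S. h \<otimes> f \<in> J"
  then obtain h where h: "h \<in> S" "h \<otimes> f \<in> J"
    by blast
  let ?G = "(\<lambda>a. loc_frac R S a \<one>) ` J"
  have "?G \<subseteq> carrier L"
    using J.Icarr S_one by auto
  then interpret K: ideal "Idl\<^bsub>L\<^esub> ?G" L
    by (rule L.genideal_ideal)
  have "loc_frac R S (h \<otimes> f) \<one> \<in> Idl\<^bsub>L\<^esub> ?G"
    using L.genideal_self[OF \<open>?G \<subseteq> carrier L\<close>] h by blast
  then have "loc_frac R S \<one> h \<otimes>\<^bsub>L\<^esub> loc_frac R S (h \<otimes> f) \<one> \<in> Idl\<^bsub>L\<^esub> ?G"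
    using h by (intro K.I_l_closed) auto
  moreover have "loc_frac R S \<one> h \<otimes>\<^bsub>L\<^esub> loc_frac R S (h \<otimes> f) \<one> = loc_frac R S f \<one>"
    using h f S_one by (simp add: mult_L) (rule loc_frac_cong; simp add: m_comm)
  ultimately show "loc_frac R S f \<one> \<in> Idl\<^bsub>L\<^esub> ?G"
    by simp
qed

end

section \<open>Contractions and associated primes in terms of ring elements\<close>

lemma loc_contraction_eq:
  assumes "primeideal P R" "ideal J R"
  shows "loc_contraction R P J = {f \<in> carrier R. \<exists>h\<in>carrier R - P. h \<otimes>\<^bsub>R\<^esub> f \<in> J}"
proof -
  interpret P: primeideal P R by fact
  interpret mult_closed_set R "carrier R - P"
  proof unfold_locales
    show "\<one>\<^bsub>R\<^esub> \<in> carrier R - P"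
      using P.I_notcarr P.one_imp_carrier by auto
    show "s \<otimes>\<^bsub>R\<^esub> t \<in> carrier R - P" if "s \<in> carrier R - P" "t \<in> carrier R - P" for s t
      using that P.I_prime[of s t] by auto
  qed auto
  show ?thesis
    unfolding loc_contraction_def using loc_frac_mem_extension_iff[OF assms(2)] by blast
qed

text \<open>Every element of the quotient is the coset of some \<open>g\<close>, so annihilators
  there turn into colon ideals of \<open>I\<close> by \<open>g\<close>.\<close>

lemma associated_primes_iff:
  assumes "ideal I R"
  shows "P \<in> associated_primes R I \<longleftrightarrow>
    primeideal P R \<and> (\<exists>g\<in>carrier R. P = {r \<in> carrier R. r \<otimes>\<^bsub>R\<^esub> g \<in> I})"
proof -
  interpret I: ideal I R by fact
  have "{r \<in> carrier R. (I +>\<^bsub>R\<^esub> r) \<otimes>\<^bsub>R Quot I\<^esub> (I +>\<^bsub>R\<^esub> g) = \<zero>\<^bsub>R Quot I\<^esub>}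
      = {r \<in> carrier R. r \<otimes>\<^bsub>R\<^esub> g \<in> I}" if "g \<in> carrier R" for g
  proof -
    have "(I +>\<^bsub>R\<^esub> r) \<otimes>\<^bsub>R Quot I\<^esub> (I +>\<^bsub>R\<^esub> g) = I +>\<^bsub>R\<^esub> (r \<otimes>\<^bsub>R\<^esub> g)" if "r \<in> carrier R" for r
      using that \<open>g \<in> carrier R\<close> by (simp add: FactRing_def I.rcoset_mult_add)
    moreover have "\<zero>\<^bsub>R Quot I\<^esub> = I"
      by (simp add: FactRing_def)
    moreover have "I +>\<^bsub>R\<^esub> x = I \<longleftrightarrow> x \<in> I" if "x \<in> carrier R" for x
      using that I.rcos_const_imp_mem I.a_rcos_zero[OF assms] by blast
    ultimately show ?thesis
      using that I.m_closed by (intro Collect_cong conj_cong refl) simp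
  qed
  moreover have "carrier (R Quot I) = {I +>\<^bsub>R\<^esub> g | g. g \<in> carrier R}"
    by (auto simp: FactRing_def A_RCOSETS_def')
  ultimately show ?thesis
    unfolding associated_primes_def by auto
qed


section \<open>Monomial ideals\<close>

notation Poly_Mapping.lookup (\<open>lookup\<close>)
notation Poly_Mapping.keys (\<open>keys\<close>)
notation Poly_Mapping.single (\<open>single\<close>)

section \<open>Exponent vectors and the polynomial ring\<close>

lemma carrier_mpoly_ring: "p \<in> carrier (mpoly_ring V) \<longleftrightarrow> (\<forall>m\<in>keys p. keys m \<subseteq> V)"
  and mult_mpoly_ring [simp]: "mult (mpoly_ring V) = (*)"
  and add_mpoly_ring [simp]: "add (mpoly_ring V) = (+)"
  and one_mpoly_ring [simp]: "one (mpoly_ring V) = 1"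
  and zero_mpoly_ring [simp]: "zero (mpoly_ring V) = 0"
  by (simp_all add: mpoly_ring_def)

lemma keys_add_nat: "keys (a + b :: 'v \<Rightarrow>\<^sub>0 nat) = keys a \<union> keys b"
  by (auto simp: in_keys_iff lookup_add)

lemma keys_mult_subset:
  fixes p q :: "('v, 'k::field) mpoly"
  shows "m \<in> keys (p * q) \<Longrightarrow> \<exists>a b. m = a + b \<and> a \<in> keys p \<and> b \<in> keys q"
  using keys_mult[of p q] by blast

lemma cring_mpoly_ring: "cring (mpoly_ring V :: ('v, 'k::field) mpoly ring)"
proof (rule cringI)
  let ?R = "mpoly_ring V :: ('v, 'k) mpoly ring"
  have add: "p + q \<in> carrier ?R" if "p \<in> carrier ?R" "q \<in> carrier ?R" for p q
    using that keys_add[of p q] by (force simp: carrier_mpoly_ring)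
  have mult: "p * q \<in> carrier ?R" if "p \<in> carrier ?R" "q \<in> carrier ?R" for p q
    using that by (fastforce simp: carrier_mpoly_ring keys_add_nat dest!: keys_mult_subset)
  have neg: "- p \<in> carrier ?R" if "p \<in> carrier ?R" for p
    using that by (simp add: carrier_mpoly_ring in_keys_iff)
  show "abelian_group ?R"
  proof (rule abelian_groupI; (simp add: add)?)
    show "0 \<in> carrier ?R"
      by (simp add: carrier_mpoly_ring)
    show "\<exists>q\<in>carrier ?R. q + p = 0" if "p \<in> carrier ?R" for p
      using neg[OF that] by force
  qed
  show "comm_monoid ?R"
  proof (rule comm_monoidI; (simp add: mult)?)
    show "1 \<in> carrier ?R"
      by (simp add: carrier_mpoly_ring)
  qed
qed (simp_all add: algebra_simps)

text \<open>\<open>M\<close> is not confined to vectors supported in \<open>V\<close>; the carrier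
  condition takes care of that. Operations on exponent sets can then ignore
  \<open>V\<close>.\<close>

definition mon_ideal :: "'v set \<Rightarrow> ('v \<Rightarrow>\<^sub>0 nat) set \<Rightarrow> ('v, 'k::field) mpoly set" where
  "mon_ideal V M = {p \<in> carrier (mpoly_ring V). keys p \<subseteq> M}"

definition upclosed :: "('v \<Rightarrow>\<^sub>0 nat) set \<Rightarrow> bool" where
  "upclosed M \<longleftrightarrow> (\<forall>m\<in>M. \<forall>u. u + m \<in> M)"

lemma upclosedD: "upclosed M \<Longrightarrow> m \<in> M \<Longrightarrow> u + m \<in> M"
  by (simp add: upclosed_def)

lemma upclosed_generated: "upclosed {u + g | u g. g \<in> G}"
  unfolding upclosed_def by (auto simp: add.assoc[symmetric]) blast

lemma ideal_mon_ideal: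
  assumes "upclosed M"
  shows "ideal (mon_ideal V M :: ('v, 'k::field) mpoly set) (mpoly_ring V)" (is "ideal ?P _")
proof -
  let ?R = "mpoly_ring V :: ('v, 'k) mpoly ring"
  interpret cring ?R by (rule cring_mpoly_ring)
  have mult: "x * p \<in> ?P" if "p \<in> ?P" "x \<in> carrier ?R" for x p :: "('v, 'k) mpoly"
    using that m_closed[of x p] upclosedD[OF assms]
    by (fastforce simp: mon_ideal_def dest!: keys_mult_subset)
  show ?thesis
  proof (rule idealI)
    show "ring ?R" by (rule ring_axioms)
    show "subgroup (?P) (add_monoid ?R)"
    proof (rule add.subgroupI)
      show "?P \<subseteq> carrier ?R"
        by (auto simp: mon_ideal_def)
      have "0 \<in> ?P"
        by (simp add: mon_ideal_def carrier_mpoly_ring)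
      then show "?P \<noteq> {}" by blast
    next
      fix p assume p: "p \<in> ?P"
      \<comment> \<open>Negation is multiplication by -1, so the absorption property already proved
        covers it.\<close>
      have "\<ominus>\<^bsub>?R\<^esub> p = (\<ominus>\<^bsub>?R\<^esub> 1) * p"
        using p l_minus[of "\<one>\<^bsub>?R\<^esub>" p] one_closed by (simp add: mon_ideal_def)
      then show "\<ominus>\<^bsub>?R\<^esub> p \<in> ?P"
        using mult p one_closed by simp
    next
      fix p q assume "p \<in> ?P" "q \<in> ?P"
      then show "p \<oplus>\<^bsub>?R\<^esub> q \<in> ?P"
        using keys_add[of p q] a_closed[of p q] by (auto simp: mon_ideal_def)
    qed
    show "x \<otimes>\<^bsub>?R\<^esub> p \<in> ?P" "p \<otimes>\<^bsub>?R\<^esub> x \<in> ?P"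
      if "p \<in> ?P" "x \<in> carrier ?R" for x p
      using mult[OF that] by (simp_all add: mult.commute)
  qed
qed

section \<open>Generators, products and powers of monomial ideals\<close>

lemma sum_of_terms: "(\<Sum>m\<in>keys p. single m (lookup p m)) = (p :: 'a \<Rightarrow>\<^sub>0 'b::comm_monoid_add)"
  by (rule poly_mapping_eqI) (auto simp: lookup_sum lookup_single when_def in_keys_iff)

text \<open>A polynomial is the finite sum of its terms. This yields the inclusions of monomial
  ideals in generated ideals and in ideal products.\<close>

lemma mem_if_terms_mem:
  fixes p :: "('v, 'k::field) mpoly"
  assumes "0 \<in> J" and "\<And>a b. a \<in> J \<Longrightarrow> b \<in> J \<Longrightarrow> a + b \<in> J"
    and "\<And>m. m \<in> keys p \<Longrightarrow> single m (lookup p m) \<in> J"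
  shows "p \<in> J"
proof -
  have "(\<Sum>m\<in>A. single m (lookup p m)) \<in> J" if "finite A" "A \<subseteq> keys p" for A
    using that by (induction A rule: finite_induct) (simp_all add: assms)
  then show ?thesis
    using sum_of_terms[of p] by (metis finite_keys subset_refl)
qed

lemma genideal_monomials:
  assumes "\<And>g. g \<in> G \<Longrightarrow> keys g \<subseteq> V"
  shows "Idl\<^bsub>mpoly_ring V\<^esub> {single g 1 | g. g \<in> G}
    = (mon_ideal V {u + g | u g. g \<in> G} :: ('v, 'k::field) mpoly set)" (is "Idl\<^bsub>?R\<^esub> ?G = ?K")
proof
  interpret cring ?R by (rule cring_mpoly_ring)
  have G: "?G \<subseteq> carrier ?R"
    using assms by (auto simp: carrier_mpoly_ring)
  show "Idl\<^bsub>?R\<^esub> ?G \<subseteq> ?K"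
  proof (rule genideal_minimal)
    show "ideal ?K ?R"
      by (intro ideal_mon_ideal upclosed_generated)
    show "?G \<subseteq> ?K"
      using G by (auto simp: mon_ideal_def intro: exI[of _ 0])
  qed
  interpret I: ideal "Idl\<^bsub>?R\<^esub> ?G" ?R
    using G by (rule genideal_ideal)
  show "?K \<subseteq> Idl\<^bsub>?R\<^esub> ?G"
  proof
    fix p assume p: "p \<in> ?K"
    show "p \<in> Idl\<^bsub>?R\<^esub> ?G"
    proof (rule mem_if_terms_mem)
      show "0 \<in> Idl\<^bsub>?R\<^esub> ?G"
        using I.zero_closed by simp
      show "a + b \<in> Idl\<^bsub>?R\<^esub> ?G" if "a \<in> Idl\<^bsub>?R\<^esub> ?G" "b \<in> Idl\<^bsub>?R\<^esub> ?G" for a b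
        using I.a_closed[OF that] by simp
      fix m assume m: "m \<in> keys p"
      then obtain u g where ug: "m = u + g" "g \<in> G"
        using p by (auto simp: mon_ideal_def)
      \<comment> \<open>Exponents cannot cancel, so the support of the cofactor \<open>u\<close>
        also lies in \<open>V\<close>.\<close>
      have "keys m \<subseteq> V"
        using p m by (auto simp: mon_ideal_def carrier_mpoly_ring)
      then have "single u (lookup p m) \<in> carrier ?R"
        by (auto simp: ug carrier_mpoly_ring keys_add_nat)
      moreover have "single g 1 \<in> Idl\<^bsub>?R\<^esub> ?G"
        using genideal_self[OF G] ug by blast
      ultimately have "single u (lookup p m) * single g 1 \<in> Idl\<^bsub>?R\<^esub> ?G"
        using I.I_l_closed by force
      then show "single m (lookup p m) \<in> Idl\<^bsub>?R\<^esub> ?G"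
        by (simp add: mult_single ug)
    qed
  qed
qed

lemma ideal_prod_mon_ideal:
  "ideal_prod (mpoly_ring V) (mon_ideal V M) (mon_ideal V N)
    = (mon_ideal V {a + b | a b. a \<in> M \<and> b \<in> N} :: ('v, 'k::field) mpoly set)"
    (is "ideal_prod ?R ?I ?J = ?K")
proof
  interpret cring ?R by (rule cring_mpoly_ring)
  show "ideal_prod ?R ?I ?J \<subseteq> ?K"
  proof
    fix p assume "p \<in> ideal_prod ?R ?I ?J"
    then show "p \<in> ?K"
    proof induction
      case (prod i j)
      then show ?case
        using m_closed[of i j] by (fastforce simp: mon_ideal_def dest!: keys_mult_subset)
    next
      case (sum p q)
      then show ?case
        using a_closed[of p q] keys_add[of p q] by (auto simp: mon_ideal_def)
    qed
  qed
  show "?K \<subseteq> ideal_prod ?R ?I ?J"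
  proof
    fix p assume p: "p \<in> ?K"
    show "p \<in> ideal_prod ?R ?I ?J"
    proof (rule mem_if_terms_mem)
      have "0 \<in> ?I" "0 \<in> ?J"
        by (simp_all add: mon_ideal_def carrier_mpoly_ring)
      then show "0 \<in> ideal_prod ?R ?I ?J"
        using ideal_prod.prod[of 0 ?I 0 ?J ?R] by simp
      show "a + b \<in> ideal_prod ?R ?I ?J" if "a \<in> ideal_prod ?R ?I ?J" "b \<in> ideal_prod ?R ?I ?J" for a b
        using ideal_prod.sum[OF that] by simp
      fix m assume m: "m \<in> keys p"
      then obtain a b where ab: "m = a + b" "a \<in> M" "b \<in> N"
        using p by (auto simp: mon_ideal_def)
      have "keys m \<subseteq> V"
        using p m by (auto simp: mon_ideal_def carrier_mpoly_ring)
      then have "single a (lookup p m) \<in> ?I" "single b 1 \<in> ?J"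
        using ab(2,3) unfolding ab(1) by (auto simp: mon_ideal_def carrier_mpoly_ring keys_add_nat)
      then have "single a (lookup p m) * single b 1 \<in> ideal_prod ?R ?I ?J"
        using ideal_prod.prod[of _ ?I _ ?J ?R] by simp
      then show "single m (lookup p m) \<in> ideal_prod ?R ?I ?J"
        by (simp add: mult_single ab)
    qed
  qed
qed

text \<open>The base case is \<open>UNIV\<close> because the zeroth power is the whole ring. It also
  makes each \<open>mon_pow M s\<close> upclosed by induction, for arbitrary
  \<open>M\<close>.\<close>

fun mon_pow :: "('v \<Rightarrow>\<^sub>0 nat) set \<Rightarrow> nat \<Rightarrow> ('v \<Rightarrow>\<^sub>0 nat) set" where
  "mon_pow M 0 = UNIV"
| "mon_pow M (Suc s) = {a + b | a b. a \<in> mon_pow M s \<and> b \<in> M}"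

lemma mon_pow_SucI: "a \<in> mon_pow M s \<Longrightarrow> b \<in> M \<Longrightarrow> a + b \<in> mon_pow M (Suc s)"
  by auto

lemma upclosed_mon_pow: "upclosed (mon_pow M s)"
proof (induction s)
  case (Suc s)
  then show ?case
    unfolding upclosed_def by (auto simp: add.assoc[symmetric]) blast
qed (simp add: upclosed_def)

lemma ideal_power_mon_ideal:
  "ideal_power (mpoly_ring V) (mon_ideal V M) s = (mon_ideal V (mon_pow M s) :: ('v, 'k::field) mpoly set)"
proof (induction s)
  case 0
  then show ?case
    by (simp add: ideal_power_def ideals_set_def nat_pow_def mon_ideal_def)
next
  case (Suc s)
  then show ?case
    by (simp add: ideal_power_def ideals_set_def nat_pow_def ideal_prod_mon_ideal)
qed

text \<open>If \<open>a + b\<close> arises from only one pair of terms, its coefficient in the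
  product is a single product of nonzero field elements. Fixing \<open>a'\<close> fixes
  \<open>b'\<close> by cancellation.\<close>

lemma sum_mem_keys_mult:
  fixes h f :: "('v, 'k::field) mpoly"
  assumes a: "a \<in> keys h" and b: "b \<in> keys f"
    and unique: "\<And>a' b'. a' \<in> keys h \<Longrightarrow> b' \<in> keys f \<Longrightarrow> a' + b' = a + b \<Longrightarrow> a' = a"
  shows "a + b \<in> keys (h * f)"
proof -
  have "lookup h l * (\<Sum>q. lookup f q when a + b = l + q) = (lookup h l * lookup f b when l = a)" for l
  proof (cases "l = a")
    case True
    then show ?thesis by simp
  next
    case False
    have "lookup h l * (lookup f q when a + b = l + q) = 0" for q
    proof (cases "l \<in> keys h \<and> q \<in> keys f")
      case True
      then have "a + b \<noteq> l + q"
        using False unique[of l q] by auto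
      then show ?thesis by simp
    qed (auto simp: in_keys_iff)
    then have "lookup h l = 0 \<or> (\<forall>q. (lookup f q when a + b = l + q) = 0)"
      by auto
    then show ?thesis
      using False by auto
  qed
  then have "lookup (h * f) (a + b) = lookup h a * lookup f b"
    by (simp add: lookup_mult)
  then show ?thesis
    using a b by (simp add: in_keys_iff)
qed

text \<open>Order monomials by their degree in the variables of \<open>C\<close> first. If \<open>a\<close> is the least monomial
  of \<open>h\<close> and \<open>b\<close> the least monomial of \<open>f\<close> violating the claim, then \<open>a + b\<close> can only cancel in
  \<open>h * f\<close> against terms already known to satisfy it.\<close>

lemma mon_ideal_contraction:
  fixes h f :: "('v::linorder, 'k::field) mpoly"
  assumes "finite C" and M: "upclosed M"
    and a0: "a0 \<in> keys h" "keys a0 \<inter> C = {}"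
    and hf: "keys (h * f) \<subseteq> M" and m: "m \<in> keys f"
  shows "\<exists>u. keys u \<inter> C = {} \<and> u + m \<in> M"
proof (rule ccontr)
  define d where "d m = (\<Sum>i\<in>C. lookup m i)" for m :: "'v \<Rightarrow>\<^sub>0 nat"
  have d_add: "d (x + y) = d x + d y" for x y
    by (simp add: d_def lookup_add sum.distrib)
  have d_0: "d x = 0 \<longleftrightarrow> keys x \<inter> C = {}" for x
    using \<open>finite C\<close> by (auto simp: d_def in_keys_iff)
  define B where "B = {b \<in> keys f. \<not> (\<exists>u. keys u \<inter> C = {} \<and> u + b \<in> M)}"
  define A0 where "A0 = {a \<in> keys h. d a = 0}"
  define e where "e = Min (d ` B)"
  define B0 where "B0 = {b \<in> B. d b = e}"
  assume "\<not> ?thesis"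
  then have "B \<noteq> {}" "finite B"
    using m by (auto simp: B_def)
  then have e: "e \<in> d ` B" "\<And>b. b \<in> B \<Longrightarrow> e \<le> d b"
    by (auto simp: e_def)
  then have B0: "B0 \<noteq> {}" "finite B0"
    using \<open>finite B\<close> by (auto simp: B0_def)
  have A0: "A0 \<noteq> {}" "finite A0"
    using a0 by (auto simp: A0_def d_0)
  define a where "a = Min A0"
  define b where "b = Min B0"
  have a: "a \<in> A0" "\<And>x. x \<in> A0 \<Longrightarrow> a \<le> x"
    using A0 by (auto simp: a_def)
  have b: "b \<in> B0" "\<And>x. x \<in> B0 \<Longrightarrow> b \<le> x"
    using B0 by (auto simp: b_def)
  \<comment> \<open>\<open>a\<close> involves no variable of \<open>C\<close>, so it can be absorbed
    into the multiplier \<open>u\<close>; a violation at \<open>b\<close> is therefore a violation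
    at \<open>a + b\<close>.\<close>
  have not_M: "u + (a + b) \<notin> M" if "keys u \<inter> C = {}" for u
  proof
    assume "u + (a + b) \<in> M"
    moreover have "keys (u + a) \<inter> C = {}"
      using that a(1) d_0 by (auto simp: A0_def keys_add_nat)
    ultimately show False
      using b(1) by (auto simp: B0_def B_def add.assoc[symmetric])
  qed
  have "a + b \<in> keys (h * f)"
  proof (rule sum_mem_keys_mult)
    show "a \<in> keys h" "b \<in> keys f"
      using a(1) b(1) by (simp_all add: A0_def B0_def B_def)
    fix a' b' assume ab': "a' \<in> keys h" "b' \<in> keys f" "a' + b' = a + b"
    show "a' = a"
    proof (cases "b' \<in> B")
      case True
      have "d a' + d b' = d a + d b"
        using ab'(3) d_add by metis
      moreover have "d a = 0" "d b = e" "e \<le> d b'"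
        using a(1) b(1) e(2) True by (simp_all add: A0_def B0_def)
      ultimately have "d a' = 0" "d b' = e"
        by auto
      \<comment> \<open>Both are minima for the linear order on exponent vectors, which is
        compatible with addition; equal sums then force equality in each summand.\<close>
      then have "a \<le> a'" "b \<le> b'"
        using a(2) b(2) ab' True by (simp_all add: A0_def B0_def)
      then show ?thesis
        using ab'(3) by (metis add_less_le_mono less_irrefl order_le_less)
    next
      case False
      then obtain u where u: "keys u \<inter> C = {}" "u + b' \<in> M"
        using ab' by (auto simp: B_def)
      then have "a' + (u + b') \<in> M"
        using M upclosedD by blast
      moreover have "a' + (u + b') = u + (a + b)"
        unfolding ab'(3)[symmetric] by (rule add.left_commute)
      ultimately show ?thesis
        using not_M u(1) by simp
    qed
  qed
  then show False
    using hf not_M[of 0] by auto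
qed

section \<open>Monomial primes and monomial witnesses for associated primes\<close>

definition mon_prime :: "'v set \<Rightarrow> 'v set \<Rightarrow> ('v, 'k::field) mpoly set" where
  "mon_prime V C = mon_ideal V {m. keys m \<inter> C \<noteq> {}}"

text \<open>An instance of \<open>mon_ideal_contraction\<close>: a polynomial \<open>h\<close>
  outside the ideal has a term free of \<open>C\<close>, and if \<open>u + m\<close> meets
  \<open>C\<close> while \<open>u\<close> does not, then \<open>m\<close> does.\<close>

lemma primeideal_mon_prime:
  fixes V C :: "'v::linorder set"
  assumes "finite C"
  shows "primeideal (mon_prime V C :: ('v, 'k::field) mpoly set) (mpoly_ring V)" (is "primeideal ?P ?R")
proof (rule primeidealI)
  have up: "upclosed {m. keys m \<inter> C \<noteq> {}}"
    by (auto simp: upclosed_def keys_add_nat)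
  show "ideal ?P ?R"
    unfolding mon_prime_def by (rule ideal_mon_ideal[OF up])
  show "cring ?R"
    by (rule cring_mpoly_ring)
  have "1 \<in> carrier ?R" "1 \<notin> ?P"
    by (auto simp: mon_prime_def mon_ideal_def carrier_mpoly_ring)
  then show "carrier ?R \<noteq> ?P" by blast
  fix h f assume hf: "h \<in> carrier ?R" "f \<in> carrier ?R" "h \<otimes>\<^bsub>?R\<^esub> f \<in> ?P"
  show "h \<in> ?P \<or> f \<in> ?P"
  proof (rule disjCI)
    assume "f \<notin> ?P"
    show "h \<in> ?P"
    proof (rule ccontr)
      assume "h \<notin> ?P"
      then obtain a0 where "a0 \<in> keys h" "keys a0 \<inter> C = {}"
        using hf by (auto simp: mon_prime_def mon_ideal_def)
      then have "\<exists>u. keys u \<inter> C = {} \<and> u + m \<in> {m. keys m \<inter> C \<noteq> {}}" if "m \<in> keys f" for m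
        using that hf by (intro mon_ideal_contraction[OF assms up]) (auto simp: mon_prime_def mon_ideal_def)
      then have "f \<in> ?P"
        using hf by (fastforce simp: mon_prime_def mon_ideal_def keys_add_nat)
      then show False
        using \<open>f \<notin> ?P\<close> by simp
    qed
  qed
qed

text \<open>The monomial with exponent \<open>g\<close> realizes the prime as a colon ideal: by
  \<open>C\<close> each variable of \<open>C\<close> sends it into the ideal, by \<open>notC\<close>
  no monomial free of \<open>C\<close> does.\<close>

lemma mon_prime_associated:
  fixes V C :: "'v::linorder set"
  assumes "finite C" "upclosed M" "keys g \<subseteq> V"
    and C: "\<And>i. i \<in> C \<Longrightarrow> single i 1 + g \<in> M"
    and notC: "\<And>u. keys u \<inter> C = {} \<Longrightarrow> u + g \<notin> M"
  shows "(mon_prime V C :: ('v, 'k::field) mpoly set) \<in> associated_primes (mpoly_ring V) (mon_ideal V M)"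
    (is "?P \<in> associated_primes ?R ?I")
proof -
  interpret cring ?R by (rule cring_mpoly_ring)
  let ?g = "single g 1 :: ('v, 'k) mpoly"
  have g: "?g \<in> carrier ?R"
    using assms(3) by (simp add: carrier_mpoly_ring)
  have mem: "m + g \<in> M \<longleftrightarrow> keys m \<inter> C \<noteq> {}" for m
  proof
    assume "keys m \<inter> C \<noteq> {}"
    then obtain i where i: "i \<in> C" "lookup m i > 0"
      by (auto simp: in_keys_iff)
    then have "m = (m - single i 1) + single i 1"
      by (intro poly_mapping_eqI) (auto simp: lookup_add lookup_minus lookup_single when_def)
    then show "m + g \<in> M"
      using upclosedD[OF assms(2) C[OF i(1)], of "m - single i 1"] by (simp add: add.assoc[symmetric])
  qed (use notC in blast)
  \<comment> \<open>Multiplication by a monomial shifts the support injectively, so nothing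
    cancels.\<close>
  have keys_g: "keys (r * ?g) = (\<lambda>m. m + g) ` keys r" for r
  proof
    show "keys (r * ?g) \<subseteq> (\<lambda>m. m + g) ` keys r"
      using keys_mult[of r ?g] by auto
    show "(\<lambda>m. m + g) ` keys r \<subseteq> keys (r * ?g)"
      by (auto intro!: sum_mem_keys_mult)
  qed
  have "r * ?g \<in> ?I \<longleftrightarrow> r \<in> ?P" if "r \<in> carrier ?R" for r
    using that m_closed[OF that g] mem by (auto simp: mon_prime_def mon_ideal_def keys_g)
  then have "?P = {r \<in> carrier ?R. r \<otimes>\<^bsub>?R\<^esub> ?g \<in> ?I}"
    by (auto simp: mon_prime_def mon_ideal_def)
  then show ?thesis
    using associated_primes_iff[OF ideal_mon_ideal[OF assms(2)]] primeideal_mon_prime[OF assms(1)] g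
    by blast
qed

text \<open>If \<open>P\<close> is the colon ideal by \<open>g\<close>, then 1 is not in
  \<open>P\<close>, so some term of \<open>g\<close> lies outside the ideal. Multiplying by a
  variable cannot cancel this term, so every variable in \<open>P\<close> moves it into
  \<open>M\<close>.\<close>

lemma associated_prime_monomial_witness:
  assumes "upclosed M" "P \<in> associated_primes (mpoly_ring V) (mon_ideal V M :: ('v, 'k::field) mpoly set)"
  obtains m where "m \<notin> M" "\<And>i. Var i \<in> P \<Longrightarrow> single i 1 + m \<in> M"
proof -
  let ?R = "mpoly_ring V :: ('v, 'k) mpoly ring" and ?I = "mon_ideal V M :: ('v, 'k) mpoly set"
  obtain g where P: "primeideal P ?R" and g: "g \<in> carrier ?R" "P = {r \<in> carrier ?R. r \<otimes>\<^bsub>?R\<^esub> g \<in> ?I}"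
    using assms(2) unfolding associated_primes_iff[OF ideal_mon_ideal[OF assms(1)]] by blast
  interpret P: primeideal P ?R by fact
  have "\<one>\<^bsub>?R\<^esub> \<notin> P"
    using P.I_notcarr P.one_imp_carrier by auto
  then have "\<one>\<^bsub>?R\<^esub> \<otimes>\<^bsub>?R\<^esub> g \<notin> ?I"
    using g(2) P.one_closed by blast
  then have "g \<notin> ?I"
    by simp
  then obtain m where m: "m \<in> keys g" "m \<notin> M"
    using g(1) by (auto simp: mon_ideal_def)
  moreover have "single i 1 + m \<in> M" if "Var i \<in> P" for i
  proof -
    have "single i 1 + m \<in> keys (Var i * g)"
      using m by (intro sum_mem_keys_mult) (auto simp: Var_def)
    moreover have "Var i * g \<in> ?I"
      using that g(2) mult_mpoly_ring by (metis (mono_tags, lifting) mem_Collect_eq)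
    ultimately show ?thesis
      by (auto simp: mon_ideal_def)
  qed
  ultimately show ?thesis
    using that by blast
qed

section \<open>Ordinary powers inside symbolic powers\<close>

lemma mem_symbolic_powerI:
  assumes "ideal I R" "ideal (ideal_power R I s) R" "f \<in> carrier R"
    and "\<And>P. P \<in> associated_primes R I \<Longrightarrow> primeideal P R \<Longrightarrow>
      \<exists>h\<in>carrier R - P. h \<otimes>\<^bsub>R\<^esub> f \<in> ideal_power R I s"
  shows "f \<in> symbolic_power R I s"
  using assms associated_primes_iff[OF assms(1)] loc_contraction_eq[OF _ assms(2)]
  unfolding symbolic_power_def by blast

lemma ideal_power_subset_symbolic_power:
  assumes "ideal I R" "ideal (ideal_power R I s) R"
  shows "ideal_power R I s \<subseteq> symbolic_power R I s"
proof
  fix f assume f: "f \<in> ideal_power R I s"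
  interpret J: ideal "ideal_power R I s" R by fact
  show "f \<in> symbolic_power R I s"
  proof (rule mem_symbolic_powerI[OF assms])
    show "f \<in> carrier R"
      using f by (rule J.Icarr)
    fix P assume "primeideal P R"
    then interpret P: primeideal P R .
    have "\<one>\<^bsub>R\<^esub> \<in> carrier R - P"
      using P.I_notcarr P.one_imp_carrier by auto
    then show "\<exists>h\<in>carrier R - P. h \<otimes>\<^bsub>R\<^esub> f \<in> ideal_power R I s"
      using f J.Icarr[OF f] by (intro bexI[of _ "\<one>\<^bsub>R\<^esub>"]) simp_all
  qed
qed


section \<open>Packings on a line\<close>

text \<open>The number of copies of the generator x_i x_{i+1}^{w_{i+1}} taken when later edges are
  served first: vertex \<open>Suc i\<close> has already given \<open>greedy n w m (Suc i)\<close>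
  units to its outgoing edge, and each copy takes \<open>w (Suc i)\<close> of the rest. No edge
  leaves \<open>n\<close>, hence the default 0.\<close>

function greedy :: "nat \<Rightarrow> (nat \<Rightarrow> nat) \<Rightarrow> (nat \<Rightarrow> nat) \<Rightarrow> nat \<Rightarrow> nat" where
  "greedy n w m i = (if i < n then min (m i) ((m (Suc i) - greedy n w m (Suc i)) div w (Suc i)) else 0)"
  by auto
termination by (relation "measure (\<lambda>(n, w, m, i). n - i)") auto

declare greedy.simps [simp del]

lemma greedy_le: "greedy n w m i \<le> m i"
  by (subst greedy.simps) simp

lemma greedy_end: "greedy n w m n = 0"
  by (subst greedy.simps) simp

lemma greedy_feasible:
  assumes "i < n"
  shows "greedy n w m (Suc i) + w (Suc i) * greedy n w m i \<le> m (Suc i)"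
proof -
  \<comment> \<open>By \<open>greedy_le\<close> this subtraction is never truncated.\<close>
  let ?r = "m (Suc i) - greedy n w m (Suc i)"
  have "greedy n w m i \<le> ?r div w (Suc i)"
    using assms by (subst greedy.simps) simp
  then have "w (Suc i) * greedy n w m i \<le> w (Suc i) * (?r div w (Suc i))"
    by simp
  also have "\<dots> \<le> ?r"
    by simp
  finally show ?thesis
    using greedy_le[of n w m "Suc i"] by linarith
qed

text \<open>Either the head \<open>Suc i\<close> limits the edge or only its tail \<open>i\<close>
  does. The strict inequality in the second case says that later edges have not exhausted
  \<open>Suc i\<close>, so the second case cannot recur at \<open>Suc i\<close>.\<close>

lemma greedy_cases:
  assumes "i < n"
  obtains "greedy n w m i = (m (Suc i) - greedy n w m (Suc i)) div w (Suc i)"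
  | "greedy n w m i = m i" "m i < (m (Suc i) - greedy n w m (Suc i)) div w (Suc i)"
proof -
  have "greedy n w m i = min (m i) ((m (Suc i) - greedy n w m (Suc i)) div w (Suc i))"
    using assms by (subst greedy.simps) simp
  then show ?thesis
    using that by (cases "m i < (m (Suc i) - greedy n w m (Suc i)) div w (Suc i)") auto
qed

text \<open>\<open>t\<close> is the largest count that fits beside \<open>t1\<close>. Exceeding it
  by \<open>Suc e\<close> forces \<open>x1\<close> below \<open>t1\<close> by at least
  \<open>Suc e\<close>, because each copy costs \<open>w \<ge> 1\<close> units.\<close>

lemma floor_exchange:
  fixes t t1 x x1 w M :: nat
  assumes "w \<ge> 1" "t = (M - t1) div w" "t1 \<le> M" "x1 + w * x \<le> M"
  shows "x \<le> t \<or> x + x1 \<le> t + t1"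
proof (rule disjCI)
  assume "\<not> x + x1 \<le> t + t1"
  show "x \<le> t"
  proof (rule ccontr)
    assume "\<not> x \<le> t"
    then obtain e where e: "x = Suc t + e"
      using less_eqE[of "Suc t" x] by auto
    have "M - t1 < w * Suc t"
      using assms(1,2) dividend_less_times_div[of w "M - t1"] by simp
    moreover have "w * x = w * Suc t + w * e"
      by (simp add: e algebra_simps)
    moreover have "e \<le> w * e"
      using assms(1) by simp
    ultimately have "x1 + Suc e \<le> t1"
      using assms(3,4) by linarith
    then show False
      using \<open>\<not> x + x1 \<le> t + t1\<close> e by linarith
  qed
qed

text \<open>\<open>C\<close> is the support of an associated prime of the line on \<open>i, \<dots>, n\<close>: a strong vertex cover.\<close>

definition strong_cover :: "nat \<Rightarrow> (nat \<Rightarrow> nat) \<Rightarrow> nat \<Rightarrow> nat set \<Rightarrow> bool" where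
  "strong_cover n w i C \<longleftrightarrow> C \<subseteq> {i..n} \<and> (\<forall>j. i \<le> j \<and> j < n \<longrightarrow> j \<in> C \<or> Suc j \<in> C) \<and>
     (\<forall>j\<in>C. (j < n \<and> Suc j \<notin> C) \<or> (i < j \<and> (j - 1 \<notin> C \<or> 2 \<le> w (j - 1))))"

text \<open>Vertex \<open>j\<close> pays one unit per use of its outgoing edge \<open>j\<close> and
  \<open>w j\<close> units per use of its incoming edge \<open>j - 1\<close>. Vertices outside
  \<open>C\<close> have unlimited capacity, as after localizing at the prime of
  \<open>C\<close>.\<close>

definition feasible_on :: "(nat \<Rightarrow> nat) \<Rightarrow> (nat \<Rightarrow> nat) \<Rightarrow> nat set \<Rightarrow> (nat \<Rightarrow> nat) \<Rightarrow> bool" where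
  "feasible_on w m C x \<longleftrightarrow> (\<forall>j\<in>C. x j + w j * x (j - 1) \<le> m j)"

text \<open>Weak duality: competing packings obey the constraints at \<open>C\<close> only, so the
  bound survives when the other exponents grow arbitrarily.\<close>

definition certifies :: "nat \<Rightarrow> (nat \<Rightarrow> nat) \<Rightarrow> (nat \<Rightarrow> nat) \<Rightarrow> nat \<Rightarrow> nat set \<Rightarrow> bool" where
  "certifies n w m i C \<longleftrightarrow> (\<forall>x. x n = 0 \<longrightarrow> feasible_on w m C x \<longrightarrow>
     (\<Sum>j=i..n. x j) \<le> (\<Sum>j=i..n. greedy n w m j))"

section \<open>Assembling certificates and strong covers from the sink end\<close>

lemma certifies_step1:
  assumes "i \<le> n" "certifies n w m (Suc i) C" "C \<subseteq> C'"
    and "\<And>x. x n = 0 \<Longrightarrow> feasible_on w m C' x \<Longrightarrow> x i \<le> greedy n w m i"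
  shows "certifies n w m i C'"
  unfolding certifies_def
proof (intro allI impI)
  fix x assume x: "x n = 0" "feasible_on w m C' x"
  then have "(\<Sum>j=Suc i..n. x j) \<le> (\<Sum>j=Suc i..n. greedy n w m j)"
    using assms(2,3) by (auto simp: certifies_def feasible_on_def)
  then show "(\<Sum>j=i..n. x j) \<le> (\<Sum>j=i..n. greedy n w m j)"
    using assms(1) assms(4)[OF x] by (simp add: sum.atLeast_Suc_atMost)
qed

text \<open>Two edges are prepended at once for the case where only their total is bounded, namely
  by the capacity of a shared vertex of weight 1.\<close>

lemma certifies_step2:
  assumes "i < n" "certifies n w m (Suc (Suc i)) C" "C \<subseteq> C'"
    and "\<And>x. x n = 0 \<Longrightarrow> feasible_on w m C' x \<Longrightarrow>
      x i + x (Suc i) \<le> greedy n w m i + greedy n w m (Suc i)"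
  shows "certifies n w m i C'"
  unfolding certifies_def
proof (intro allI impI)
  fix x assume x: "x n = 0" "feasible_on w m C' x"
  then have "(\<Sum>j=Suc (Suc i)..n. x j) \<le> (\<Sum>j=Suc (Suc i)..n. greedy n w m j)"
    using assms(2,3) by (auto simp: certifies_def feasible_on_def)
  moreover have "(\<Sum>j=i..n. y j) = y i + y (Suc i) + (\<Sum>j=Suc (Suc i)..n. y j)" for y :: "nat \<Rightarrow> nat"
    using assms(1) by (simp add: sum.atLeast_Suc_atMost)
  ultimately show "(\<Sum>j=i..n. x j) \<le> (\<Sum>j=i..n. greedy n w m j)"
    using assms(4)[OF x] by simp
qed

lemma certifies_end: "n \<le> i \<Longrightarrow> certifies n w m i C"
  by (cases "i = n") (auto simp: certifies_def)

lemma strong_cover_end: "n \<le> i \<Longrightarrow> strong_cover n w i {}"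
  by (auto simp: strong_cover_def)

text \<open>Since \<open>i\<close> is outside the certifying set, the greedy packing stays optimal if \<open>m i\<close> is replaced by
  infinity.\<close>

lemma certifies_tail:
  assumes w: "\<And>j. i < j \<Longrightarrow> j \<le> n \<Longrightarrow> 1 \<le> w j" and "i < n"
    and t: "greedy n w m i = (m (Suc i) - greedy n w m (Suc i)) div w (Suc i)"
  shows "certifies n w m i {Suc i..n}"
proof -
  have "(\<Sum>j=k..n. x j) \<le> (\<Sum>j=k..n. greedy n w m j)"
    if "i \<le> k" and x: "x n = 0" "feasible_on w m {Suc i..n} x" for k x
    using \<open>i \<le> k\<close>
  \<comment> \<open>Strong induction, because the exchange may settle one edge or two.\<close>
  proof (induction "n - k" arbitrary: k rule: less_induct)
    case less
    consider "n < k" | "k = n" | "k < n" by linarith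
    then show ?case
    proof cases
      assume "k < n"
      let ?t = "greedy n w m"
      have sums: "(\<Sum>j=k..n. y j) = y k + (\<Sum>j=Suc k..n. y j)"
          "(\<Sum>j=k..n. y j) = y k + y (Suc k) + (\<Sum>j=Suc (Suc k)..n. y j)" for y :: "nat \<Rightarrow> nat"
        using \<open>k < n\<close> by (simp_all add: sum.atLeast_Suc_atMost)
      have IH: "(\<Sum>j=Suc k..n. x j) \<le> (\<Sum>j=Suc k..n. ?t j)"
        using less \<open>k < n\<close> by simp
      have IH2: "(\<Sum>j=Suc (Suc k)..n. x j) \<le> (\<Sum>j=Suc (Suc k)..n. ?t j)"
        using less \<open>k < n\<close> by simp
      have feas: "x j + w j * x (j - 1) \<le> m j" if "i < j" "j \<le> n" for j
        using x that by (auto simp: feasible_on_def)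
      have "x k \<le> ?t k \<or> x k + x (Suc k) \<le> ?t k + ?t (Suc k)"
        using \<open>k < n\<close>
      proof (cases rule: greedy_cases[of k n w m])
        case 1
        then show ?thesis
          using feas[of "Suc k"] w[of "Suc k"] less.prems \<open>k < n\<close>
          by (intro floor_exchange[OF _ 1 greedy_le]) auto
      next
        case 2
        \<comment> \<open>The bound \<open>x k \<le> m k\<close> comes from the constraint at
          \<open>k\<close>, present only for \<open>k > i\<close>; at \<open>k = i\<close> the
          hypothesis \<open>t\<close> excludes this case.\<close>
        then have "k \<noteq> i"
          using t by auto
        then show ?thesis
          using 2 feas[of k] less.prems \<open>k < n\<close> by simp
      qed
      then show ?thesis
      proof
        assume "x k \<le> ?t k"
        then show ?thesis
          unfolding sums(1) using IH by linarith
      next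
        assume "x k + x (Suc k) \<le> ?t k + ?t (Suc k)"
        then show ?thesis
          unfolding sums(2) using IH2 by linarith
      qed
    qed (use x in auto)
  qed
  then show ?thesis
    by (simp add: certifies_def)
qed

text \<open>\<open>Suc i\<close> covers both new edges and is justified by the absence of
  \<open>i\<close>. A vertex of \<open>C\<close> equal to \<open>Suc (Suc i)\<close> was justified
  by its missing successor, which is unaffected.\<close>

lemma strong_cover_insert_Suc:
  assumes "i < n" "strong_cover n w (Suc (Suc i)) C"
  shows "strong_cover n w i (insert (Suc i) C)"
proof -
  have C: "C \<subseteq> {Suc (Suc i)..n}" "\<And>j. Suc (Suc i) \<le> j \<Longrightarrow> j < n \<Longrightarrow> j \<in> C \<or> Suc j \<in> C"
    "\<And>j. j \<in> C \<Longrightarrow> (j < n \<and> Suc j \<notin> C) \<or> (Suc (Suc i) < j \<and> (j - 1 \<notin> C \<or> 2 \<le> w (j - 1)))"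
    using assms(2) unfolding strong_cover_def by blast+
  show ?thesis
    unfolding strong_cover_def
  proof (intro conjI ballI allI impI)
    show "insert (Suc i) C \<subseteq> {i..n}"
      using C(1) assms(1) by auto
    show "j \<in> insert (Suc i) C \<or> Suc j \<in> insert (Suc i) C" if "i \<le> j \<and> j < n" for j
      using C(2)[of j] that by (cases "j = i \<or> j = Suc i") auto
    fix j assume "j \<in> insert (Suc i) C"
    then consider "j = Suc i" | "j \<in> C" by blast
    then show "(j < n \<and> Suc j \<notin> insert (Suc i) C) \<or>
        (i < j \<and> (j - 1 \<notin> insert (Suc i) C \<or> 2 \<le> w (j - 1)))"
    proof cases
      assume "j = Suc i"
      then show ?thesis using C(1) by auto
    next
      assume j: "j \<in> C"
      then have "Suc (Suc i) \<le> j" using C(1) by auto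
      then show ?thesis using C(3)[OF j] by auto
    qed
  qed
qed

text \<open>The first vertex has no predecessor to justify it, hence the requirement that
  \<open>Suc i\<close> be missing.\<close>

lemma strong_cover_insert_first:
  assumes "i < n" "strong_cover n w (Suc i) C" "Suc i \<notin> C"
  shows "strong_cover n w i (insert i C)"
proof -
  have C: "C \<subseteq> {Suc i..n}" "\<And>j. Suc i \<le> j \<Longrightarrow> j < n \<Longrightarrow> j \<in> C \<or> Suc j \<in> C"
    "\<And>j. j \<in> C \<Longrightarrow> (j < n \<and> Suc j \<notin> C) \<or> (Suc i < j \<and> (j - 1 \<notin> C \<or> 2 \<le> w (j - 1)))"
    using assms(2) unfolding strong_cover_def by blast+
  show ?thesis
    unfolding strong_cover_def
  proof (intro conjI ballI allI impI)
    show "insert i C \<subseteq> {i..n}"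
      using C(1) assms(1) by auto
    show "j \<in> insert i C \<or> Suc j \<in> insert i C" if "i \<le> j \<and> j < n" for j
      using C(2)[of j] that by (cases "j = i") auto
    fix j assume "j \<in> insert i C"
    then consider "j = i" | "j \<in> C" by blast
    then show "(j < n \<and> Suc j \<notin> insert i C) \<or> (i < j \<and> (j - 1 \<notin> insert i C \<or> 2 \<le> w (j - 1)))"
    proof cases
      assume "j = i"
      then show ?thesis using assms(1,3) by auto
    next
      assume j: "j \<in> C"
      then have "Suc i \<le> j" using C(1) by auto
      then show ?thesis using C(3)[OF j] by auto
    qed
  qed
qed

text \<open>Builds the cover and the optimality bound together, following which vertex limits each
  greedy edge. The weight condition \<open>tail\<close> makes a full tail of the line a strong
  cover.\<close>

lemma exists_certificate:
  assumes w: "\<And>j. 1 \<le> j \<Longrightarrow> j \<le> n \<Longrightarrow> 1 \<le> w j"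
    and tail: "\<And>i j. 1 < j \<Longrightarrow> j < n \<Longrightarrow> 2 \<le> w j \<Longrightarrow> j \<le> i \<Longrightarrow> i \<le> n - 1 \<Longrightarrow> 2 \<le> w i"
    and "1 \<le> i"
  shows "\<exists>C. strong_cover n w i C \<and> certifies n w m i C"
  using \<open>1 \<le> i\<close>
proof (induction "n - i" arbitrary: i rule: less_induct)
  case less
  let ?t = "greedy n w m"
  \<comment> \<open>When the head limits edge \<open>k\<close>, the certificate can avoid
    \<open>k\<close>; this leaves room to insert \<open>k\<close> or to stop the cover
    there.\<close>
  have tight: "\<exists>C. strong_cover n w k C \<and> certifies n w m k C \<and> k \<notin> C"
    if k: "i \<le> k" "k < n" "?t k = (m (Suc k) - ?t (Suc k)) div w (Suc k)" for k
  proof (cases "Suc k < n \<and> w (Suc k) = 1")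
    case True
    then obtain C where C: "strong_cover n w (Suc (Suc k)) C" "certifies n w m (Suc (Suc k)) C"
      using less.hyps[of "Suc (Suc k)"] k by fastforce
    \<comment> \<open>With weight 1 the floor is exact, so vertex \<open>Suc k\<close> is saturated
      and bounds both edges at once.\<close>
    have t: "?t k + ?t (Suc k) = m (Suc k)"
      using k(3) True greedy_le[of n w m "Suc k"] by simp
    have "certifies n w m k (insert (Suc k) C)"
      using t True by (intro certifies_step2[OF k(2) C(2)]) (auto simp: feasible_on_def)
    moreover have "k \<notin> insert (Suc k) C"
      using C(1) by (auto simp: strong_cover_def)
    ultimately show ?thesis
      using strong_cover_insert_Suc[OF k(2) C(1)] by blast
  next
    case False
    \<comment> \<open>Either \<open>Suc k = n\<close>, or \<open>w (Suc k) \<ge> 2\<close> and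
      \<open>tail\<close> gives weight at least 2 to every predecessor inside the set.\<close>
    have "strong_cover n w k {Suc k..n}"
      unfolding strong_cover_def
    proof (intro conjI ballI allI impI)
      fix j assume "j \<in> {Suc k..n}"
      then consider "j = Suc k" | "Suc k < j" "j \<le> n" by fastforce
      then show "(j < n \<and> Suc j \<notin> {Suc k..n}) \<or> (k < j \<and> (j - 1 \<notin> {Suc k..n} \<or> 2 \<le> w (j - 1)))"
      proof cases
        assume j: "Suc k < j" "j \<le> n"
        then have "2 \<le> w (Suc k)"
          using False w[of "Suc k"] by linarith
        then have "2 \<le> w (j - 1)"
          using tail[of "Suc k" "j - 1"] j less.prems k(1) by simp
        then show ?thesis
          using j by auto
      qed auto
    qed auto
    moreover have "certifies n w m k {Suc k..n}"
      using w less.prems k by (intro certifies_tail) auto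
    ultimately show ?thesis
      by auto
  qed
  show ?case
  proof (cases "i < n")
    case False
    then show ?thesis
      using certifies_end strong_cover_end by (metis not_less)
  next
    case True
    then show ?thesis
    proof (cases rule: greedy_cases[of i n w m])
      case 1
      then show ?thesis
        using tight[of i] True by blast
    next
      case 2
      \<comment> \<open>Vertex \<open>i\<close> limits edge \<open>i\<close>, so \<open>i\<close>
        must join the cover. This needs a certificate avoiding \<open>Suc i\<close>: the empty one
        at the end of the line, otherwise one from \<open>tight\<close>.\<close>
      have "\<exists>C. strong_cover n w (Suc i) C \<and> certifies n w m (Suc i) C \<and> Suc i \<notin> C"
      proof (cases "Suc i = n")
        case True
        then show ?thesis
          using certifies_end strong_cover_end by blast
      next
        case False
        then have "Suc i < n"
          using True by simp
        then show ?thesis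
        proof (cases rule: greedy_cases[of "Suc i" n w m])
          case 1
          then show ?thesis
            using tight[of "Suc i"] \<open>Suc i < n\<close> by simp
        next
          assume "?t (Suc i) = m (Suc i)"
          then show ?thesis
            using 2(2) by simp
        qed
      qed
      then obtain C where C: "strong_cover n w (Suc i) C" "certifies n w m (Suc i) C" "Suc i \<notin> C"
        by blast
      have "certifies n w m i (insert i C)"
        using True 2(1) by (intro certifies_step1[OF _ C(2)]) (auto simp: feasible_on_def)
      then show ?thesis
        using strong_cover_insert_first[OF True C(1,3)] by blast
    qed
  qed
qed


section \<open>The edge ideal of a line\<close>

definition edge_mon :: "(nat \<Rightarrow> nat) \<Rightarrow> nat \<Rightarrow> nat \<Rightarrow>\<^sub>0 nat" where
  "edge_mon w i = single i 1 + single (Suc i) (w (Suc i))"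

definition line_mons :: "nat \<Rightarrow> (nat \<Rightarrow> nat) \<Rightarrow> (nat \<Rightarrow>\<^sub>0 nat) set" where
  "line_mons n w = {u + g | u g. g \<in> edge_mon w ` {1..<n}}"

lemma lookup_edge_mon:
  "lookup (edge_mon w i) j = (if j = i then 1 else if j = Suc i then w j else 0)"
  by (simp add: edge_mon_def lookup_add lookup_single when_def)

lemma upclosed_le:
  assumes "upclosed M" "x \<in> M" "\<And>j. lookup x j \<le> lookup m j"
  shows "m \<in> M"
proof -
  have "m = (m - x) + x"
    using assms(3) by (intro poly_mapping_eqI) (simp add: lookup_add lookup_minus)
  then show ?thesis
    using upclosedD[OF assms(1,2)] by metis
qed

lemma upclosed_line_mons: "upclosed (line_mons n w)"
  unfolding line_mons_def by (rule upclosed_generated)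

lemma edge_mon_in_line_mons: "1 \<le> i \<Longrightarrow> i < n \<Longrightarrow> edge_mon w i \<in> line_mons n w"
  unfolding line_mons_def by (rule CollectI, rule exI[of _ 0], rule exI[of _ "edge_mon w i"]) simp

lemma line_mons_iff:
  "m \<in> line_mons n w \<longleftrightarrow> (\<exists>i. 1 \<le> i \<and> i < n \<and> 1 \<le> lookup m i \<and> w (Suc i) \<le> lookup m (Suc i))"
proof
  assume "m \<in> line_mons n w"
  then obtain u i where i: "1 \<le> i" "i < n" and m: "m = u + edge_mon w i"
    by (auto simp: line_mons_def)
  show "\<exists>i. 1 \<le> i \<and> i < n \<and> 1 \<le> lookup m i \<and> w (Suc i) \<le> lookup m (Suc i)"
    using i by (intro exI[of _ i]) (simp add: m lookup_add lookup_edge_mon)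
next
  assume "\<exists>i. 1 \<le> i \<and> i < n \<and> 1 \<le> lookup m i \<and> w (Suc i) \<le> lookup m (Suc i)"
  then obtain i where i: "1 \<le> i" "i < n" "1 \<le> lookup m i" "w (Suc i) \<le> lookup m (Suc i)"
    by blast
  then show "m \<in> line_mons n w"
    by (intro upclosed_le[OF upclosed_line_mons edge_mon_in_line_mons[OF i(1,2)]])
      (auto simp: lookup_edge_mon)
qed

text \<open>\<open>x j\<close> is the number of times the \<open>j\<close>-th edge generator is used in a product dividing \<open>m\<close>.\<close>

definition packing :: "nat \<Rightarrow> (nat \<Rightarrow> nat) \<Rightarrow> (nat \<Rightarrow> nat) \<Rightarrow> nat \<Rightarrow> (nat \<Rightarrow> nat) \<Rightarrow> bool" where
  "packing n w m s x \<longleftrightarrow> x 0 = 0 \<and> x n = 0 \<and> feasible_on w m {1..n} x \<and> s \<le> (\<Sum>j=1..n. x j)"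

section \<open>Membership in powers of the edge ideal via packings\<close>

lemma sum_fun_upd_in:
  fixes x :: "nat \<Rightarrow> nat"
  assumes "finite A" "i \<in> A"
  shows "(\<Sum>j\<in>A. (x(i := y)) j) + x i = (\<Sum>j\<in>A. x j) + y"
  using sum.remove[OF assms, of x] sum.remove[OF assms, of "x(i := y)"]
  by (simp add: sum.cong[of "A - {i}" _ "x(i := y)" x])

lemma mon_pow_imp_packing:
  assumes "m \<in> mon_pow (line_mons n w) s"
  shows "\<exists>x. packing n w (lookup m) s x"
  using assms
proof (induction s arbitrary: m)
  case 0
  have "packing n w (lookup m) 0 (\<lambda>_. 0)"
    by (simp add: packing_def feasible_on_def)
  then show ?case by blast
next
  case (Suc s)
  then obtain a u i where a: "a \<in> mon_pow (line_mons n w) s" and i: "1 \<le> i" "i < n"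
    and m: "m = a + (u + edge_mon w i)"
    by (auto simp: line_mons_def)
  from Suc.IH[OF a] obtain x where x: "packing n w (lookup a) s x"
    by blast
  have "packing n w (lookup m) (Suc s) (x(i := Suc (x i)))"
    unfolding packing_def
  proof (intro conjI)
    show "feasible_on w (lookup m) {1..n} (x(i := Suc (x i)))"
      unfolding feasible_on_def
    proof
      fix j assume j: "j \<in> {1..n}"
      then have "x j + w j * x (j - 1) \<le> lookup a j"
        using x by (auto simp: packing_def feasible_on_def)
      then show "(x(i := Suc (x i))) j + w j * (x(i := Suc (x i))) (j - 1) \<le> lookup m j"
        using j by (auto simp: m lookup_add lookup_edge_mon)
    qed
    show "Suc s \<le> (\<Sum>j=1..n. (x(i := Suc (x i))) j)"
      using x sum_fun_upd_in[of "{1..n}" i x "Suc (x i)"] i by (simp add: packing_def)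
  qed (use x i in \<open>auto simp: packing_def\<close>)
  then show ?case by blast
qed

text \<open>Some edge is used at least once; splitting off one copy of its generator leaves a
  packing with total at least \<open>s\<close>.\<close>

lemma packing_imp_mon_pow:
  assumes "packing n w (lookup m) s x"
  shows "m \<in> mon_pow (line_mons n w) s"
  using assms
proof (induction s arbitrary: m x)
  case 0
  then show ?case by simp
next
  case (Suc s)
  have "(\<Sum>j=1..n. x j) \<noteq> 0"
    using Suc.prems unfolding packing_def by linarith
  then obtain i where "i \<in> {1..n}" "x i \<noteq> 0"
    by (rule sum.not_neutral_contains_not_neutral)
  then have i: "1 \<le> i" "i < n" "x i \<noteq> 0"
    using Suc.prems by (auto simp: packing_def le_less)
  have feas: "x j + w j * x (j - 1) \<le> lookup m j" if "1 \<le> j" "j \<le> n" for j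
    using Suc.prems that by (auto simp: packing_def feasible_on_def)
  let ?e = "edge_mon w i" and ?y = "x(i := x i - 1)"
  have le: "?y j + w j * ?y (j - 1) + lookup ?e j \<le> lookup m j" if "1 \<le> j" "j \<le> n" for j
  proof -
    have "w (Suc i) * (x i - 1) + w (Suc i) = w (Suc i) * x i"
      using i(3) by (cases "x i") auto
    then show ?thesis
      using feas[OF that] i by (auto simp: lookup_edge_mon)
  qed
  have "lookup ?e j \<le> lookup m j" for j
    using le[of j] i by (cases "1 \<le> j \<and> j \<le> n") (auto simp: lookup_edge_mon)
  then have m: "m = (m - ?e) + ?e"
    by (intro poly_mapping_eqI) (simp add: lookup_add lookup_minus)
  have "packing n w (lookup (m - ?e)) s ?y"
    unfolding packing_def
  proof (intro conjI)
    show "feasible_on w (lookup (m - ?e)) {1..n} ?y"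
      unfolding feasible_on_def lookup_minus using le by (fastforce simp: le_diff_conv2)
    have "(\<Sum>j=1..n. ?y j) + x i = (\<Sum>j=1..n. x j) + (x i - 1)"
      using i by (intro sum_fun_upd_in) auto
    moreover have "Suc s \<le> (\<Sum>j=1..n. x j)"
      using Suc.prems by (simp add: packing_def)
    ultimately show "s \<le> (\<Sum>j=1..n. ?y j)"
      using i(3) by linarith
  qed (use Suc.prems i in \<open>auto simp: packing_def\<close>)
  then have "m - ?e \<in> mon_pow (line_mons n w) s"
    by (rule Suc.IH)
  then show ?case
    using m edge_mon_in_line_mons[OF i(1,2)] by auto
qed

text \<open>The recursion may give a nonzero value at 0, but no edge enters vertex 1, so that value
  is overwritten.\<close>

lemma packing_greedy:
  assumes "s \<le> (\<Sum>j=1..n. greedy n w m j)"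
  shows "packing n w m s (\<lambda>j. if j = 0 then 0 else greedy n w m j)"
  unfolding packing_def
proof (intro conjI)
  show "feasible_on w m {1..n} (\<lambda>j. if j = 0 then 0 else greedy n w m j)"
    unfolding feasible_on_def
  proof
    fix j assume "j \<in> {1..n}"
    then show "(if j = 0 then 0 else greedy n w m j)
        + w j * (if j - 1 = 0 then 0 else greedy n w m (j - 1)) \<le> m j"
      using greedy_feasible[of "j - 1" n w m] greedy_le[of n w m j] by auto
  qed
  have "(\<Sum>j=1..n. if j = 0 then 0 else greedy n w m j) = (\<Sum>j=1..n. greedy n w m j)"
    by (rule sum.cong) auto
  then show "s \<le> (\<Sum>j=1..n. if j = 0 then 0 else greedy n w m j)"
    using assms by simp
qed (simp_all add: greedy_end)

text \<open>The two alternatives in the strong cover condition say which edge a vertex of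
  \<open>C\<close> is one unit short of completing in a suitable monomial.\<close>

lemma strong_cover_associated:
  assumes w: "\<And>j. 1 \<le> j \<Longrightarrow> j \<le> n \<Longrightarrow> 1 \<le> w j" and C: "strong_cover n w 1 C"
  shows "(mon_prime {1..n} C :: (nat, 'k::field) mpoly set)
    \<in> associated_primes (mpoly_ring {1..n}) (mon_ideal {1..n} (line_mons n w))"
proof -
  \<comment> \<open>Outside \<open>C\<close> the exponent is positive and at least every weight. A
    vertex of \<open>C\<close> with missing successor gets 0, one short as a tail; any other gets
    \<open>w i - 1\<close>, one short as a head.\<close>
  define e where "e i = (if i \<notin> {1..n} then 0 else if i \<notin> C then 1 + (\<Sum>j=1..n. w j)
    else if i < n \<and> Suc i \<notin> C then 0 else w i - 1)" for i
  define g where "g = Abs_poly_mapping e"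
  have "finite {i. e i \<noteq> 0}"
    by (rule finite_subset[of _ "{1..n}"]) (auto simp: e_def)
  then have g: "lookup g = e"
    by (simp add: g_def)
  have sub: "C \<subseteq> {1..n}" and cover: "\<And>j. 1 \<le> j \<Longrightarrow> j < n \<Longrightarrow> j \<in> C \<or> Suc j \<in> C"
    and strong: "\<And>j. j \<in> C \<Longrightarrow>
      (j < n \<and> Suc j \<notin> C) \<or> (1 < j \<and> (j - 1 \<notin> C \<or> 2 \<le> w (j - 1)))"
    using C unfolding strong_cover_def by blast+
  have big: "w i \<le> e i" if "i \<in> {1..n}" "i \<notin> C" for i
    using that member_le_sum[of i "{1..n}" w] by (simp add: e_def)
  show ?thesis
  proof (rule mon_prime_associated)
    show "finite C"
      using sub finite_subset by blast
    show "upclosed (line_mons n w)"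
      by (rule upclosed_line_mons)
    show "keys g \<subseteq> {1..n}"
      by (auto simp: in_keys_iff g e_def split: if_splits)
    show "single i 1 + g \<in> line_mons n w" if i: "i \<in> C" for i
    proof (cases "i < n \<and> Suc i \<notin> C")
      case True
      then show ?thesis
        unfolding line_mons_iff using i sub big[of "Suc i"]
        by (intro exI[of _ i]) (auto simp: lookup_add lookup_single g)
    next
      case False
      then have i1: "1 < i" "i - 1 \<notin> C \<or> 2 \<le> w (i - 1)" "i \<le> n" "Suc (i - 1) = i"
        using strong[OF i] i sub by auto
      then have "1 \<le> e (i - 1)"
        using i by (auto simp: e_def)
      moreover have "w i \<le> 1 + e i"
        using False i sub i1 by (auto simp: e_def)
      ultimately show ?thesis
        unfolding line_mons_iff using i1
        by (intro exI[of _ "i - 1"]) (auto simp: lookup_add lookup_single g)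
    qed
    show "u + g \<notin> line_mons n w" if u: "keys u \<inter> C = {}" for u
    proof
      assume "u + g \<in> line_mons n w"
      then obtain i where i: "1 \<le> i" "i < n" "1 \<le> lookup u i + e i"
          "w (Suc i) \<le> lookup u (Suc i) + e (Suc i)"
        by (auto simp: line_mons_iff lookup_add g)
      have u0: "lookup u j = 0" if "j \<in> C" for j
        using u that by (auto simp: in_keys_iff)
      show False
      \<comment> \<open>Multipliers free of \<open>C\<close> cannot repair the shortage: if the head
        is in \<open>C\<close> its exponent is below its weight, otherwise the tail is in
        \<open>C\<close> with exponent 0.\<close>
      proof (cases "Suc i \<in> C")
        case True
        then show False
          using i u0[OF True] w[of "Suc i"] by (auto simp: e_def split: if_splits)
      next
        case False
        then have "i \<in> C"
          using cover i by blast
        then show False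
          using i u0[of i] False by (auto simp: e_def)
      qed
    qed
  qed
qed

section \<open>Sufficiency of the weight condition\<close>

lemma symbolic_power_line_subset:
  fixes w :: "nat \<Rightarrow> nat"
  assumes w: "\<And>j. 1 \<le> j \<Longrightarrow> j \<le> n \<Longrightarrow> 1 \<le> w j"
    and tail: "\<And>i j. 1 < j \<Longrightarrow> j < n \<Longrightarrow> 2 \<le> w j \<Longrightarrow> j \<le> i \<Longrightarrow> i \<le> n - 1 \<Longrightarrow> 2 \<le> w i"
  defines "I \<equiv> mon_ideal {1..n} (line_mons n w) :: (nat, 'k::field) mpoly set"
  shows "symbolic_power (mpoly_ring {1..n}) I s \<subseteq> ideal_power (mpoly_ring {1..n}) I s"
proof
  let ?R = "mpoly_ring {1..n} :: (nat, 'k) mpoly ring" and ?M = "mon_pow (line_mons n w) s"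
  fix f assume f: "f \<in> symbolic_power ?R I s"
  have "m \<in> ?M" if m: "m \<in> keys f" for m
  proof -
    \<comment> \<open>The prime is chosen separately for each term \<open>m\<close> of
      \<open>f\<close>.\<close>
    obtain C where C: "strong_cover n w 1 C" "certifies n w (lookup m) 1 C"
      using exists_certificate[of n w 1 "lookup m"] w tail by blast
    then have sub: "C \<subseteq> {1..n}"
      by (auto simp: strong_cover_def)
    have "f \<in> loc_contraction ?R (mon_prime {1..n} C) (ideal_power ?R I s)"
      using f strong_cover_associated[OF w C(1)] unfolding symbolic_power_def I_def by blast
    then obtain h where h: "h \<in> carrier ?R" "h \<notin> mon_prime {1..n} C" "h * f \<in> mon_ideal {1..n} ?M"
      unfolding I_def ideal_power_mon_ideal
        loc_contraction_eq[OF primeideal_mon_prime[OF finite_subset[OF sub finite_atLeastAtMost]]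
          ideal_mon_ideal[OF upclosed_mon_pow]]
      by auto
    then obtain a0 where "a0 \<in> keys h" "keys a0 \<inter> C = {}"
      by (auto simp: mon_prime_def mon_ideal_def)
    then obtain u where u: "keys u \<inter> C = {}" "u + m \<in> ?M"
      using mon_ideal_contraction[OF finite_subset[OF sub finite_atLeastAtMost] upclosed_mon_pow] h(3) m
      by (metis (no_types, lifting) mem_Collect_eq mon_ideal_def)
    then obtain x where x: "packing n w (lookup (u + m)) s x"
      using mon_pow_imp_packing by blast
    \<comment> \<open>The multiplier leaves the exponents in \<open>C\<close> unchanged, and the
      certificate looks at no others.\<close>
    have "lookup (u + m) j = lookup m j" if "j \<in> C" for j
      using u(1) that by (auto simp: lookup_add in_keys_iff)
    then have "feasible_on w (lookup m) C x"
      using x sub unfolding packing_def feasible_on_def by (metis subsetD)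
    then have "s \<le> (\<Sum>j=1..n. greedy n w (lookup m) j)"
      using x C(2) unfolding certifies_def packing_def by (meson le_trans)
    then show "m \<in> ?M"
      using packing_greedy packing_imp_mon_pow by blast
  qed
  moreover have "f \<in> carrier ?R"
    using f by (simp add: symbolic_power_def)
  ultimately show "f \<in> ideal_power ?R I s"
    unfolding I_def ideal_power_mon_ideal by (auto simp: mon_ideal_def)
qed

section \<open>Necessity of the weight condition\<close>

lemma Var_power: "Var i ^ k = single (single i k) 1"
  by (induction k) (simp_all add: Var_def mult_single single_add[symmetric])

lemma (in primeideal) one_not_mem: "\<one> \<notin> I"
  using I_notcarr one_imp_carrier by blast

text \<open>Avoids determining the associated primes: the witness \<open>m\<close> of any such
  \<open>P\<close> yields a variable outside \<open>P\<close>, and a power of that variable serves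
  as the denominator.\<close>

lemma mem_symbolic_power_monomialI:
  fixes I :: "('v, 'k::field) mpoly set"
  assumes M: "upclosed M" and I: "I = mon_ideal V M" and f: "keys f \<subseteq> V"
    and ex: "\<And>m. m \<notin> M \<Longrightarrow>
      \<exists>i k. i \<in> V \<and> single i 1 + m \<notin> M \<and> single i k + f \<in> mon_pow M s"
  shows "single f 1 \<in> symbolic_power (mpoly_ring V) I s"
proof (rule mem_symbolic_powerI)
  let ?R = "mpoly_ring V :: ('v, 'k) mpoly ring"
  show "ideal I ?R" "ideal (ideal_power ?R I s) ?R"
    unfolding I ideal_power_mon_ideal using ideal_mon_ideal M upclosed_mon_pow by blast+
  show "single f 1 \<in> carrier ?R"
    using f by (simp add: carrier_mpoly_ring)
  fix P assume P: "P \<in> associated_primes ?R I" and "primeideal P ?R"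
  then interpret P: primeideal P ?R by simp
  obtain m where m: "m \<notin> M" "\<And>i. Var i \<in> P \<Longrightarrow> single i 1 + m \<in> M"
    using associated_prime_monomial_witness[OF M P[unfolded I]] by blast
  then obtain i k where ik: "i \<in> V" "Var i \<notin> P" "single i k + f \<in> mon_pow M s"
    using ex[OF m(1)] by blast
  have Var: "Var i ^ j \<in> carrier ?R" for j
    using ik(1) by (simp add: Var_power carrier_mpoly_ring)
  have "Var i ^ j \<notin> P" for j
  proof (induction j)
    case 0
    then show ?case
      using P.one_not_mem by simp
  next
    case (Suc j)
    then show ?case
      using P.I_prime[of "Var i" "Var i ^ j"] ik(2) Var[of j] Var[of 1] by auto
  qed
  moreover have "Var i ^ k * single f 1 \<in> ideal_power ?R I s"
    unfolding I ideal_power_mon_ideal using ik f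
    by (simp add: Var_power mult_single mon_ideal_def carrier_mpoly_ring keys_add_nat)
  ultimately show "\<exists>h\<in>carrier ?R - P. h \<otimes>\<^bsub>?R\<^esub> single f 1 \<in> ideal_power ?R I s"
    using Var by (intro bexI[of _ "Var i ^ k"]) auto
qed

text \<open>A variable moves \<open>m\<close> into the ideal only by completing its outgoing edge
  from exponent 0 or its incoming edge from one unit short. Weight 1 at \<open>Suc b\<close> makes
  both alternatives mean exponent 0 there, and this propagates to a contradiction at the next two
  vertices.\<close>

lemma line_witness:
  assumes w: "\<And>j. 1 \<le> j \<Longrightarrow> j \<le> n \<Longrightarrow> 1 \<le> w j"
    and b: "1 < b" "Suc b < n" "2 \<le> w b" "w (Suc b) = 1"
    and m: "m \<notin> line_mons n w"
  shows "\<exists>i\<in>{b..b + 3} \<inter> {1..n}. single i 1 + m \<notin> line_mons n w"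
proof (rule ccontr)
  assume "\<not> ?thesis"
  then have mem: "single i 1 + m \<in> line_mons n w" if "b \<le> i" "i \<le> b + 3" "i \<le> n" for i
    using that b by auto
  have not: "lookup m i = 0 \<or> lookup m (Suc i) < w (Suc i)" if "1 \<le> i" "i < n" for i
    using m that unfolding line_mons_iff by fastforce
  have x: "(i < n \<and> w (Suc i) \<le> lookup m (Suc i) \<and> lookup m i = 0)
      \<or> (1 < i \<and> 1 \<le> lookup m (i - 1) \<and> lookup m i + 1 = w i)" if "b \<le> i" "i \<le> b + 3" "i \<le> n" for i
  proof -
    have "single i 1 + m \<in> line_mons n w"
      using that by (rule mem)
    then obtain k where k: "1 \<le> k" "k < n" "1 \<le> lookup (single i 1 + m) k"
        "w (Suc k) \<le> lookup (single i 1 + m) (Suc k)"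
      unfolding line_mons_iff by blast
    consider "k = i" | "Suc k = i" | "k \<noteq> i" "Suc k \<noteq> i" by blast
    then show ?thesis
    proof cases
      assume "k = i"
      then show ?thesis
        using k not[of i] by (auto simp: lookup_add lookup_single)
    next
      assume "Suc k = i"
      then show ?thesis
        using k not[of k] by (auto simp: lookup_add lookup_single)
    next
      assume "k \<noteq> i" "Suc k \<noteq> i"
      then show ?thesis
        using k not[of k] by (auto simp: lookup_add lookup_single)
    qed
  qed
  have c0: "lookup m (Suc b) = 0"
    using x[of "Suc b"] b by auto
  then have b1: "1 \<le> lookup m b"
    using x[of b] b by auto
  \<comment> \<open>The edge from \<open>Suc b\<close> cannot be completed, its tail being absent,
    so the outgoing edge must exist and be completed. Then \<open>b + 3\<close> has full exponent
    but an absent predecessor, and neither alternative holds there.\<close>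
  have d: "Suc (Suc b) < n" "w (b + 3) \<le> lookup m (b + 3)" "lookup m (Suc (Suc b)) = 0"
    using x[of "Suc (Suc b)"] b c0 by (auto simp: numeral_3_eq_3)
  then show False
    using x[of "b + 3"] w[of "b + 3"] by (auto simp: numeral_3_eq_3)
qed

lemma symbolic_power_line_neq:
  fixes w :: "nat \<Rightarrow> nat"
  assumes w: "\<And>j. 1 \<le> j \<Longrightarrow> j \<le> n \<Longrightarrow> 1 \<le> w j"
    and b: "1 < b" "Suc b < n" "2 \<le> w b" "w (Suc b) = 1"
  defines "I \<equiv> mon_ideal {1..n} (line_mons n w) :: (nat, 'k::field) mpoly set"
  shows "\<exists>s\<ge>1. symbolic_power (mpoly_ring {1..n}) I s \<noteq> ideal_power (mpoly_ring {1..n}) I s"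
proof -
  define a where "a = b - 1"
  have a: "b = Suc a" "1 \<le> a"
    using b by (simp_all add: a_def)
  let ?M = "line_mons n w"
  let ?E = "edge_mon w"
  define v where "v = w (a + 3)"
  have v: "1 \<le> v"
    using w[of "a + 3"] b by (simp add: v_def a)
  \<comment> \<open>Edges \<open>a + 1\<close> and \<open>a + 2\<close> each take one unit of vertex
    \<open>a + 2\<close>, so the exponent \<open>s - 1\<close> chosen there in \<open>f\<close> caps
    their joint use just below \<open>s\<close>.\<close>
  define s :: nat where "s = (if v = 1 then 3 else 2)"
  define f where "f = single a 1 + single (a + 1) (w b) + single (a + 2) (s - 1) + single (a + 3) (1::nat)"
  have lf: "lookup f j = (if j = a then 1 else if j = a + 1 then w b else if j = a + 2 then s - 1
      else if j = a + 3 then 1 else 0)" for j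
    by (auto simp: f_def lookup_add lookup_single when_def)
  have E: "?E i \<in> ?M" if "1 \<le> i" "i < n" for i
    using that by (rule edge_mon_in_line_mons)
  have pow2: "x \<in> mon_pow ?M 2" if "1 \<le> i" "i < n" "1 \<le> j" "j < n"
    "\<And>l. lookup (?E i + ?E j) l \<le> lookup x l" for x i j
  proof (rule upclosed_le[OF upclosed_mon_pow _ that(5)])
    show "?E i + ?E j \<in> mon_pow ?M 2"
      using E[OF that(1,2)] E[OF that(3,4)] by (force simp: numeral_2_eq_2 intro: exI[of _ 0])
  qed
  have pow3: "x \<in> mon_pow ?M 3" if "1 \<le> i" "i < n" "1 \<le> j" "j < n" "1 \<le> k" "k < n"
    "\<And>l. lookup (?E i + ?E j + ?E k) l \<le> lookup x l" for x i j k
  proof (rule upclosed_le[OF upclosed_mon_pow _ that(7)])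
    have "?E i + ?E j \<in> mon_pow ?M 2"
      using that(1-4) by (rule pow2) simp
    then have "?E i + ?E j + ?E k \<in> mon_pow ?M (Suc 2)"
      using E[OF that(5,6)] by (rule mon_pow_SucI)
    then show "?E i + ?E j + ?E k \<in> mon_pow ?M 3"
      by simp
  qed
  note lookups = lf lookup_add lookup_single when_def lookup_edge_mon s_def v_def eval_nat_numeral
  \<comment> \<open>The extra power of one variable pays for one more generator. Where edge
    \<open>a + 1\<close> is used twice, it takes two units of \<open>b\<close>, available since
    \<open>2 \<le> w b\<close>.\<close>
  have mult: "\<exists>k. single i k + f \<in> mon_pow ?M s" if ib: "i \<in> {b..b + 3} \<inter> {1..n}" for i
  proof -
    consider "i = a + 1" | "i = a + 2" | "i = a + 3" | "i = a + 4" "a + 4 \<le> n"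
      using ib a by fastforce
    then show ?thesis
    proof cases
      assume i: "i = a + 1"
      have "single i 1 + f \<in> mon_pow ?M s"
      proof (cases "v = 1")
        case True
        have "single i 1 + f \<in> mon_pow ?M 3"
          by (rule pow3[of a "a + 1" "a + 2"]) (use a b i True in \<open>auto simp: lookups\<close>)
        then show ?thesis using True by (simp add: s_def)
      next
        case False
        have "single i 1 + f \<in> mon_pow ?M 2"
          by (rule pow2[of a "a + 1"]) (use a b i False in \<open>auto simp: lookups\<close>)
        then show ?thesis using False by (simp add: s_def)
      qed
      then show ?thesis by blast
    next
      assume i: "i = a + 2"
      have "single i 1 + f \<in> mon_pow ?M s"
      proof (cases "v = 1")
        case True
        have "single i 1 + f \<in> mon_pow ?M 3"
          by (rule pow3[of "a + 1" "a + 1" "a + 2"]) (use a b i True in \<open>auto simp: lookups\<close>)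
        then show ?thesis using True by (simp add: s_def)
      next
        case False
        have "single i 1 + f \<in> mon_pow ?M 2"
          by (rule pow2[of "a + 1" "a + 1"]) (use a b i False in \<open>auto simp: lookups\<close>)
        then show ?thesis using False by (simp add: s_def)
      qed
      then show ?thesis by blast
    next
      assume i: "i = a + 3"
      have "single i v + f \<in> mon_pow ?M s"
      proof (cases "v = 1")
        case True
        have "single i v + f \<in> mon_pow ?M 3"
          by (rule pow3[of a "a + 2" "a + 2"]) (use a b i True in \<open>auto simp: lookups\<close>)
        then show ?thesis using True by (simp add: s_def)
      next
        case False
        have "single i v + f \<in> mon_pow ?M 2"
          by (rule pow2[of a "a + 2"]) (use a b i False in \<open>auto simp: lookups\<close>)
        then show ?thesis using False by (simp add: s_def)
      qed
      then show ?thesis by blast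
    next
      assume i: "i = a + 4" "a + 4 \<le> n"
      have "single i (w i) + f \<in> mon_pow ?M s"
      proof (cases "v = 1")
        case True
        have "single i (w i) + f \<in> mon_pow ?M 3"
          by (rule pow3[of "a + 1" "a + 1" "a + 3"]) (use a b i True in \<open>auto simp: lookups\<close>)
        then show ?thesis using True by (simp add: s_def)
      next
        case False
        have "single i (w i) + f \<in> mon_pow ?M 2"
          by (rule pow2[of "a + 1" "a + 3"]) (use a b i False in \<open>auto simp: lookups\<close>)
        then show ?thesis using False by (simp add: s_def)
      qed
      then show ?thesis by blast
    qed
  qed
  have keys_f: "keys f \<subseteq> {1..n}"
    using a b by (auto simp: in_keys_iff lf split: if_splits)
  have "single f 1 \<in> symbolic_power (mpoly_ring {1..n}) I s"
  proof (rule mem_symbolic_power_monomialI[OF upclosed_line_mons I_def[THEN meta_eq_to_obj_eq] keys_f])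
    fix m assume "m \<notin> ?M"
    then obtain i where "i \<in> {b..b + 3} \<inter> {1..n}" "single i 1 + m \<notin> ?M"
      using line_witness[OF w b] by blast
    then show "\<exists>i k. i \<in> {1..n} \<and> single i 1 + m \<notin> ?M \<and> single i k + f \<in> mon_pow ?M s"
      using mult by blast
  qed
  moreover have "single f 1 \<notin> ideal_power (mpoly_ring {1..n}) I s"
  proof
    assume "single f 1 \<in> ideal_power (mpoly_ring {1..n}) I s"
    then have "f \<in> mon_pow ?M s"
      unfolding I_def ideal_power_mon_ideal by (simp add: mon_ideal_def)
    then obtain x where x: "packing n w (lookup f) s x"
      using mon_pow_imp_packing by blast
    have feas: "x j + w j * x (j - 1) \<le> lookup f j" if "1 \<le> j" "j \<le> n" for j
      using x that by (auto simp: packing_def feasible_on_def)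
    have "a + 3 \<le> n"
      using a b by simp
    \<comment> \<open>The head of this edge is either missing or has exponent 0 in
      \<open>f\<close>.\<close>
    have x3: "x (a + 3) = 0"
    proof (cases "a + 3 = n")
      case True
      then show ?thesis using x by (simp add: packing_def)
    next
      case False
      then show ?thesis
        using feas[of "a + 4"] w[of "a + 4"] \<open>a + 3 \<le> n\<close> by (simp add: lf eval_nat_numeral)
    qed
    have x_zero: "x j = 0" if "j \<in> {1..n} - {a, a + 1, a + 2}" for j
      using feas[of j] that x3 by (cases "j = a + 3") (auto simp: lf)
    have "(\<Sum>j=1..n. x j) = (\<Sum>j\<in>{a, a + 1, a + 2}. x j)"
      using a \<open>a + 3 \<le> n\<close> x_zero by (intro sum.mono_neutral_right) auto
    then have "s \<le> x a + x (a + 1) + x (a + 2)"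
      using x by (simp add: packing_def)
    moreover have "x a \<le> 1" "x (a + 1) + w b * x a \<le> w b" "x (a + 2) + x (a + 1) \<le> s - 1"
      "v * x (a + 2) \<le> 1"
      using feas[of a] feas[of "a + 1"] feas[of "a + 2"] feas[of "a + 3"] a b \<open>a + 3 \<le> n\<close>
      by (auto simp: lf v_def eval_nat_numeral)
    moreover have "x (a + 2) \<le> (if v = 1 then 1 else 0)"
      using \<open>v * x (a + 2) \<le> 1\<close> v by (cases "x (a + 2)"; cases "v = 1") auto
    \<comment> \<open>One use of edge \<open>a\<close> exhausts vertex \<open>b\<close>. Without it
      the total is at most \<open>s - 1\<close> by vertex \<open>a + 2\<close>; with it,
      \<open>1 + x (a + 2)\<close> is at most \<open>s - 1\<close> by vertex
      \<open>a + 3\<close>.\<close>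
    moreover have "x a = 0 \<or> x (a + 1) = 0"
      using \<open>x (a + 1) + w b * x a \<le> w b\<close> by (cases "x a") auto
    ultimately show False
      by (auto simp: s_def split: if_splits)
  qed
  moreover have "1 \<le> s"
    by (simp add: s_def)
  ultimately show ?thesis
    by blast
qed

section \<open>From the graph to exponent vectors, and the equivalence\<close>

lemma edge_ideal_line:
  assumes "vertices D = {1..n}" "edges D = {(i, i + 1) | i. 1 \<le> i \<and> i \<le> n - 1}"
  shows "edge_ideal D = (mon_ideal {1..n} (line_mons n (weight D)) :: (nat, 'k::field) mpoly set)"
proof -
  let ?w = "weight D"
  let ?G = "edge_mon ?w ` {1..<n}"
  have "{Var u * Var v ^ ?w v | u v. (u, v) \<in> edges D} = {single g (1::'k) | g. g \<in> ?G}"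
  proof -
    have "Var i * Var (Suc i) ^ ?w (Suc i) = single (edge_mon ?w i) (1::'k)" for i
      by (simp add: Var_power) (simp add: Var_def mult_single edge_mon_def)
    then show ?thesis
      unfolding assms(2) by fastforce
  qed
  moreover have "keys g \<subseteq> {1..n}" if "g \<in> ?G" for g
    using that by (auto simp: edge_mon_def keys_add_nat split: if_splits)
  ultimately show ?thesis
    unfolding edge_ideal_def assms(1) line_mons_def using genideal_monomials[of ?G "{1..n}"] by simp
qed

theorem theorem3p6:
  fixes D :: "nat wo_graph" and n :: nat
    and R :: "(nat, 'k::field) mpoly ring" and I :: "(nat, 'k) mpoly set"
  assumes "weighted_oriented_graph D"
    and "n \<ge> 1"
    and "vertices D = {1..n}"
    and "edges D = {(i, i + 1) | i. 1 \<le> i \<and> i \<le> n - 1}"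
  defines "R \<equiv> mpoly_ring (vertices D)"
    and "I \<equiv> edge_ideal D"
  shows "(\<forall>s\<ge>1. symbolic_power R I s = ideal_power R I s) \<longleftrightarrow>
    (\<forall>j. 1 < j \<and> j < n \<and> weight D j \<ge> 2 \<longrightarrow> (\<forall>i. j \<le> i \<and> i \<le> n - 1 \<longrightarrow> weight D i \<ge> 2))"
proof -
  let ?w = "weight D"
  have w: "1 \<le> ?w j" if "1 \<le> j" "j \<le> n" for j
    using weighted_oriented_graph.weight_pos[OF assms(1)] assms(3) that by simp
  have R: "R = mpoly_ring {1..n}"
    by (simp add: R_def assms(3))
  have I: "I = mon_ideal {1..n} (line_mons n ?w)"
    unfolding I_def by (rule edge_ideal_line[OF assms(3,4)])
  show ?thesis
  proof
    assume eq: "\<forall>s\<ge>1. symbolic_power R I s = ideal_power R I s"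
    show "\<forall>j. 1 < j \<and> j < n \<and> 2 \<le> ?w j \<longrightarrow> (\<forall>i. j \<le> i \<and> i \<le> n - 1 \<longrightarrow> 2 \<le> ?w i)"
    proof (intro allI impI)
      fix j i assume j: "1 < j \<and> j < n \<and> 2 \<le> ?w j" and "j \<le> i \<and> i \<le> n - 1"
      then have "j \<le> i" "i < n" by auto
      then show "2 \<le> ?w i"
      \<comment> \<open>Moving along the line from \<open>j\<close>, a first failure would give
        adjacent vertices \<open>b\<close>, \<open>Suc b\<close> of weight at least 2 and exactly 1,
        as \<open>symbolic_power_line_neq\<close> requires.\<close>
      proof (induction i rule: dec_induct)
        case base
        then show ?case using j by simp
      next
        case (step b)
        show ?case
        proof (rule ccontr)
          assume "\<not> 2 \<le> ?w (Suc b)"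
          then have "?w (Suc b) = 1"
            using w[of "Suc b"] step by simp
          then show False
            using symbolic_power_line_neq[of n ?w b, where 'k = 'k] w eq j step unfolding R I by auto
        qed
      qed
    qed
  next
    assume tail: "\<forall>j. 1 < j \<and> j < n \<and> 2 \<le> ?w j \<longrightarrow> (\<forall>i. j \<le> i \<and> i \<le> n - 1 \<longrightarrow> 2 \<le> ?w i)"
    show "\<forall>s\<ge>1. symbolic_power R I s = ideal_power R I s"
    proof (intro allI impI equalityI)
      fix s :: nat
      show "symbolic_power R I s \<subseteq> ideal_power R I s"
        unfolding R I using tail w by (intro symbolic_power_line_subset) blast+
      show "ideal_power R I s \<subseteq> symbolic_power R I s"
        unfolding R I
        by (intro ideal_power_subset_symbolic_power)
          (auto simp: ideal_power_mon_ideal intro: ideal_mon_ideal upclosed_mon_pow upclosed_line_mons)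
    qed
  qed
qed

end
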